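(* Let $(S,X)$ be a Markov shift, $(T,Y)$ be a dynamical system, and let $\pi:X^\#\to Y$ be an excellent semiconjugacy. Let $\mu$ be an ergodic $T$-invariant Borel probability measure with $\mu(\pi(X^\#))=1$. Then there exist a Markov shift $\hat X$ and a semiconjugacy $\hat\pi:\hat X^\#\to Y$ such that: <br/>(1) $\hat\pi:\hat X^\#\to Y$ is an excellent semiconjugacy. Moreover, if $\pi$ admits a multiplicity bound, so does $\hat\pi$; <br/>(2) if $X$ is locally compact, so is $\hat X$; <br/>(3) $\hat\pi=\pi\circ q|_{\hat X^\#}$ where $q:\hat X\to X$ is a $1$-Lipschitz map with $q(\hat X^\#)\subset X^\#$; <br/>(4) $q:\hat X^\#\to X^\#$ is proper, i.e., $q^{-1}(K)\cap\hat X^\#$ is compact for any compact $K\subset X^\#$; <br/>(5) $\hat\pi(\hat X^\#)\subset\pi(X^\#)$ and for $\mu$-a.e. $y\in Y$, $|\hat\pi^{-1}(y)|=1$; <br/>(6) there is an invariant probability measure $\hat\mu$ on $\hat X$ such that $\hat\pi:(S,\hat\mu)\to(T,\mu)$ is an isomorphism (of measure-preserving systems, $S$ denoting the shift on $\hat X$); <br/>(7) $\hat X$ is irreducible.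
   Context: A dynamical system $(T,Y)$ is a Borel automorphism of a standard Borel space; all measures are ergodic, invariant, Borel probability measures. A symbolic system $(S,X)$ over a countable (possibly finite) alphabet $\mathcal A$ is a shift-invariant subset $X\subset\mathcal A^{\mathbb Z}$ with the shift $S:(x_n)\mapsto(x_{n+1})$ and distance $d(x,y)=\exp(-\inf\{|n|:x_n\neq y_n\})$. A Markov shift is the symbolic system of bi-infinite paths on a simple directed graph with vertex set $\mathcal A$ (at most one arrow from $a$ to $b$); it is irreducible if for any two symbols $a,b$ there is a path from $a$ to $b$ on the graph. Its regular part $X^\#$ is the set of $x\in X$ for which there are $u,v\in\mathcal A$ such that $\{n\ge0:x_{-n}=u\}$ and $\{n\ge0:x_n=v\}$ are both infinite. A semiconjugacy $\pi:(S,Z)\to(T,Y)$ is a map $\pi:Z\to Y$ (not necessarily onto) with $\pi\circ S=T\circ\pi$. A semiconjugacy $\pi$ on a symbolic system $Z\subset\mathcal A^{\mathbb Z}$ is excellent if it is Borel, finite-to-one (every $\pi^{-1}(y)$, $y\in Y$, is finite), and there is a reflexive, symmetric and locally finite relation $\sim$ on $\mathcal A$ (locally finite: $\{b:b\sim a\}$ is finite for each $a\in\mathcal A$) such that for all $x,y\in Z$: $\pi(x)=\pi(y)\iff\forall n\in\mathbb Z\ x_n\sim y_n$. A function $C:\mathcal A\times\mathcal A\to\{0,1,2,\dots\}$ is a multiplicity bound for $\pi:X^\#\to Y$ if for all $x\in X^\#$, $|\pi^{-1}(\pi(x))|\le C(a,b)$ for every $(a,b)\in\mathcal A\times\mathcal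 A$ such that $x_{-n}=a$ for infinitely many positive integers $n$ and $x_n=b$ for infinitely many positive integers $n$. A map $q$ between metric spaces is $1$-Lipschitz if $d(q(x),q(y))\le d(x,y)$ (it need not commute with the shifts). *)

theory Defs
  imports "HOL-Probability.Probability"
begin

section \<open>Symbolic systems and Markov shifts\<close>

definition shift_map :: "(int \<Rightarrow> 'a) \<Rightarrow> (int \<Rightarrow> 'a)"
  where "shift_map x = (\<lambda>n. x (n + 1))"

text \<open>The case \<open>x = y\<close> is separate because the infimum of the empty set, which is infinite on
  paper, is unspecified in \<^typ>\<open>real\<close>.\<close>

definition symb_dist :: "(int \<Rightarrow> 'a) \<Rightarrow> (int \<Rightarrow> 'a) \<Rightarrow> real"
  where "symb_dist x y =
    (if x = y then 0 else exp (- (INF n\<in>{n. x n \<noteq> y n}. real_of_int \<bar>n\<bar>)))"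

lemma symb_dist_attained:
  assumes "x \<noteq> y"
  obtains n where "x n \<noteq> y n" "symb_dist x y = exp (- real_of_int \<bar>n\<bar>)"
    "\<And>k. x k \<noteq> y k \<Longrightarrow> \<bar>n\<bar> \<le> \<bar>k\<bar>"
proof -
  obtain m where m: "x m \<noteq> y m" using assms by auto
  define n where "n = arg_min (\<lambda>k. nat \<bar>k\<bar>) (\<lambda>k. x k \<noteq> y k)"
  have n: "x n \<noteq> y n" unfolding n_def by (rule arg_min_natI[of _ m]) (rule m)
  have "nat \<bar>n\<bar> \<le> nat \<bar>k\<bar>" if "x k \<noteq> y k" for k
    unfolding n_def using that by (rule arg_min_nat_le)
  then have min: "\<bar>n\<bar> \<le> \<bar>k\<bar>" if "x k \<noteq> y k" for k
    using that by fastforce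
  have "(INF n\<in>{n. x n \<noteq> y n}. real_of_int \<bar>n\<bar>) = real_of_int \<bar>n\<bar>"
  proof (rule cInf_eq_minimum)
    show "real_of_int \<bar>n\<bar> \<in> (\<lambda>n. real_of_int \<bar>n\<bar>) ` {n. x n \<noteq> y n}"
      using n by blast
  next
    fix r assume "r \<in> (\<lambda>n. real_of_int \<bar>n\<bar>) ` {n. x n \<noteq> y n}"
    then obtain k where "x k \<noteq> y k" "r = real_of_int \<bar>k\<bar>" by blast
    with min show "real_of_int \<bar>n\<bar> \<le> r" by (simp only: of_int_le_iff)
  qed
  then have "symb_dist x y = exp (- real_of_int \<bar>n\<bar>)"
    using assms by (simp add: symb_dist_def)
  with n min that show thesis by blast
qed

lemma symb_dist_ge:
  assumes "x n \<noteq> y n"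
  shows "exp (- real_of_int \<bar>n\<bar>) \<le> symb_dist x y"
proof -
  have "x \<noteq> y" using assms by auto
  then show ?thesis using assms symb_dist_attained by (metis exp_le_cancel_iff neg_le_iff_le of_int_le_iff)
qed

lemma symb_dist_nonneg: "0 \<le> symb_dist x y"
  by (simp add: symb_dist_def)

lemma symb_dist_eq_0_iff: "symb_dist x y = 0 \<longleftrightarrow> x = y"
  by (simp add: symb_dist_def)

lemma symb_dist_commute: "symb_dist x y = symb_dist y x"
proof -
  have "{n. x n \<noteq> y n} = {n. y n \<noteq> x n}" by auto
  then show ?thesis by (auto simp: symb_dist_def)
qed

lemma symb_dist_triangle: "symb_dist x z \<le> symb_dist x y + symb_dist y z"
proof (cases "x = z")
  case True
  then show ?thesis using symb_dist_nonneg[of x y] symb_dist_nonneg[of y z]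
    by (simp add: symb_dist_def)
next
  case False
  then obtain n where n: "x n \<noteq> z n" "symb_dist x z = exp (- real_of_int \<bar>n\<bar>)"
    by (rule symb_dist_attained)
  then have "x n \<noteq> y n \<or> y n \<noteq> z n" by auto
  then show ?thesis
    using n(2) symb_dist_ge[of x n y] symb_dist_ge[of y n z]
      symb_dist_nonneg[of x y] symb_dist_nonneg[of y z] by linarith
qed

lemma Metric_space_symb_dist: "Metric_space X symb_dist"
  by unfold_locales
    (use symb_dist_nonneg symb_dist_commute symb_dist_eq_0_iff symb_dist_triangle in blast)+

abbreviation symb_topology :: "(int \<Rightarrow> 'a) set \<Rightarrow> (int \<Rightarrow> 'a) topology"
  where "symb_topology X \<equiv> Metric_space.mtopology X symb_dist"

text \<open>The carrier \<open>V\<close> is the alphabet; representing the arrows by a set of pairs makes the graph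
  simple (loops are allowed).\<close>

definition countable_graph :: "'a set \<Rightarrow> 'a rel \<Rightarrow> bool"
  where "countable_graph V E \<longleftrightarrow> countable V \<and> E \<subseteq> V \<times> V"

definition markov_shift :: "'a rel \<Rightarrow> (int \<Rightarrow> 'a) set"
  where "markov_shift E = {x. \<forall>n. (x n, x (n + 1)) \<in> E}"

definition irreducible_graph :: "'a set \<Rightarrow> 'a rel \<Rightarrow> bool"
  where "irreducible_graph V E \<longleftrightarrow> (\<forall>a\<in>V. \<forall>b\<in>V. (a, b) \<in> E\<^sup>+)"

definition regular_part :: "'a set \<Rightarrow> (int \<Rightarrow> 'a) set \<Rightarrow> (int \<Rightarrow> 'a) set"
  where "regular_part V X = {x \<in> X. \<exists>u\<in>V. \<exists>v\<in>V.
    infinite {n::nat. x (- int n) = u} \<and> infinite {n::nat. x (int n) = v}}"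

abbreviation markov_regular :: "'a set \<Rightarrow> 'a rel \<Rightarrow> (int \<Rightarrow> 'a) set"
  where "markov_regular V E \<equiv> regular_part V (markov_shift E)"

definition one_lipschitz_on :: "(int \<Rightarrow> 'a) set \<Rightarrow> ((int \<Rightarrow> 'a) \<Rightarrow> (int \<Rightarrow> 'b)) \<Rightarrow> bool"
  where "one_lipschitz_on X q \<longleftrightarrow>
    (\<forall>x\<in>X. \<forall>y\<in>X. symb_dist (q x) (q y) \<le> symb_dist x y)"


section \<open>Dynamical systems\<close>

definition borel_of :: "'a topology \<Rightarrow> 'a measure"
  where "borel_of T = sigma (topspace T) {U. openin T U}"

text \<open>Only the measurable structure (\<^const>\<open>space\<close> and \<^const>\<open>sets\<close>) of \<open>Y\<close> matters.\<close>

definition standard_borel :: "'y measure \<Rightarrow> bool"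
  where "standard_borel Y \<longleftrightarrow>
    (\<exists>\<tau>. completely_metrizable_space \<tau> \<and> second_countable \<tau> \<and>
         space Y = topspace \<tau> \<and> sets Y = sets (borel_of \<tau>))"

definition dynamical_system :: "'y measure \<Rightarrow> ('y \<Rightarrow> 'y) \<Rightarrow> bool"
  where "dynamical_system Y T \<longleftrightarrow> standard_borel Y \<and>
    bij_betw T (space Y) (space Y) \<and> T \<in> measurable Y Y \<and>
    the_inv_into (space Y) T \<in> measurable Y Y"

definition ergodic_measure :: "'y measure \<Rightarrow> ('y \<Rightarrow> 'y) \<Rightarrow> 'y measure \<Rightarrow> bool"
  where "ergodic_measure Y T \<mu> \<longleftrightarrow> prob_space \<mu> \<and> sets \<mu> = sets Y \<and>
    (\<forall>A\<in>sets Y. emeasure \<mu> (T -` A \<inter> space Y) = emeasure \<mu> A) \<and>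
    (\<forall>A\<in>sets Y. T -` A \<inter> space Y = A \<longrightarrow> emeasure \<mu> A = 0 \<or> emeasure \<mu> A = 1)"

text \<open>Isomorphism modulo null sets, for invertible systems \<open>(S, M)\<close>, \<open>(T, N)\<close> and a map \<open>f\<close> that
  is only meaningful on \<open>D\<close>.\<close>

definition mps_isomorphism ::
    "'x set \<Rightarrow> 'x measure \<Rightarrow> ('x \<Rightarrow> 'x) \<Rightarrow> 'y measure \<Rightarrow> ('y \<Rightarrow> 'y) \<Rightarrow> ('x \<Rightarrow> 'y) \<Rightarrow> bool"
  where "mps_isomorphism D M S N T f \<longleftrightarrow>
    (\<exists>A\<in>sets M. \<exists>B\<in>sets N. A \<subseteq> D \<and>
      emeasure M (space M - A) = 0 \<and> emeasure N (space N - B) = 0 \<and>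
      S ` A = A \<and> T ` B = B \<and> bij_betw f A B \<and>
      f \<in> measurable (restrict_space M A) (restrict_space N B) \<and>
      the_inv_into A f \<in> measurable (restrict_space N B) (restrict_space M A) \<and>
      (\<forall>x\<in>A. f (S x) = T (f x)) \<and>
      (\<forall>C\<in>sets N. C \<subseteq> B \<longrightarrow> emeasure M (f -` C \<inter> A) = emeasure N C))"


section \<open>Excellent semiconjugacies\<close>

definition semiconjugacy ::
    "(int \<Rightarrow> 'a) set \<Rightarrow> 'y measure \<Rightarrow> ('y \<Rightarrow> 'y) \<Rightarrow> ((int \<Rightarrow> 'a) \<Rightarrow> 'y) \<Rightarrow> bool"
  where "semiconjugacy Z Y T p \<longleftrightarrow>
    (\<forall>x\<in>Z. p x \<in> space Y) \<and> (\<forall>x\<in>Z. p (shift_map x) = T (p x))"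

definition locally_finite_on :: "'a set \<Rightarrow> 'a rel \<Rightarrow> bool"
  where "locally_finite_on V R \<longleftrightarrow> (\<forall>a\<in>V. finite {b\<in>V. (b, a) \<in> R})"

definition excellent_semiconjugacy ::
    "'a set \<Rightarrow> (int \<Rightarrow> 'a) set \<Rightarrow> 'y measure \<Rightarrow> ('y \<Rightarrow> 'y) \<Rightarrow> ((int \<Rightarrow> 'a) \<Rightarrow> 'y) \<Rightarrow> bool"
  where "excellent_semiconjugacy V Z Y T p \<longleftrightarrow>
    semiconjugacy Z Y T p \<and>
    p \<in> measurable (borel_of (symb_topology Z)) Y \<and>
    (\<forall>y\<in>space Y. finite {z\<in>Z. p z = y}) \<and>
    (\<exists>R. R \<subseteq> V \<times> V \<and> refl_on V R \<and> sym R \<and> locally_finite_on V R \<and>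
      (\<forall>x\<in>Z. \<forall>y\<in>Z. p x = p y \<longleftrightarrow> (\<forall>n. (x n, y n) \<in> R)))"

definition multiplicity_bound ::
    "'a set \<Rightarrow> (int \<Rightarrow> 'a) set \<Rightarrow> ((int \<Rightarrow> 'a) \<Rightarrow> 'y) \<Rightarrow> ('a \<Rightarrow> 'a \<Rightarrow> nat) \<Rightarrow> bool"
  where "multiplicity_bound V Z p C \<longleftrightarrow>
    (\<forall>x\<in>Z. \<forall>a\<in>V. \<forall>b\<in>V.
      infinite {n::nat. 0 < n \<and> x (- int n) = a} \<and> infinite {n::nat. 0 < n \<and> x (int n) = b} \<longrightarrow>
      finite {z\<in>Z. p z = p x} \<and> card {z\<in>Z. p z = p x} \<le> C a b)"

end

theory Submission
  imports Defs
begin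

text \<open>Call the fiber of \<open>y\<close> the finite set of regular points over \<open>y\<close>. Since \<open>\<pi>\<close> is governed by a
  symbolwise relation, two points of a fiber that meet at some time can be spliced into a third point
  of the same fiber. If fibers with such meetings had positive measure, recurrence would produce
  infinitely many points in one fiber; hence for almost every \<open>y\<close> distinct points of the fiber differ
  at every time. The vertices of the new graph are finite sets of pairwise related symbols, with an
  arrow from \<open>D\<close> to \<open>D'\<close> if the arrows of the old graph restrict to a perfect matching between them, and
  one keeps the irreducible component of a set \<open>D\<^sub>0\<close> that occurs as a slice of the fiber with positive
  probability. A path in the new graph is a bundle of strands, and \<open>q\<close> follows the strand through a
  chosen symbol at time \<open>0\<close>. The slices of the fiber of a typical \<open>y\<close> form the only path over \<open>y\<close>, because
  the strands of any such path are already the entire fiber.\<close>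

section \<open>Sequence spaces\<close>

definition agree :: "nat \<Rightarrow> (int \<Rightarrow> 'a) \<Rightarrow> (int \<Rightarrow> 'a) \<Rightarrow> bool"
  where "agree m x y \<longleftrightarrow> (\<forall>n. \<bar>n\<bar> \<le> int m \<longrightarrow> x n = y n)"

lemma agree_refl [simp]: "agree m x x"
  by (simp add: agree_def)

lemma agree_sym: "agree m x y \<Longrightarrow> agree m y x"
  by (simp add: agree_def)

lemma agree_trans: "agree m x y \<Longrightarrow> agree m y z \<Longrightarrow> agree m x z"
  by (simp add: agree_def)

lemma agree_mono: "agree m x y \<Longrightarrow> k \<le> m \<Longrightarrow> agree k x y"
  by (simp add: agree_def)

lemma symb_dist_less_iff_agree: "symb_dist x y < exp (- real m) \<longleftrightarrow> agree m x y"
proof (cases "x = y")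
  case True
  then show ?thesis by (simp add: symb_dist_def)
next
  case False
  then obtain n where n: "x n \<noteq> y n" "symb_dist x y = exp (- real_of_int \<bar>n\<bar>)"
      "\<And>k. x k \<noteq> y k \<Longrightarrow> \<bar>n\<bar> \<le> \<bar>k\<bar>"
    using symb_dist_attained by metis
  have "symb_dist x y < exp (- real m) \<longleftrightarrow> int m < \<bar>n\<bar>"
    using n(2) by auto
  also have "\<dots> \<longleftrightarrow> agree m x y"
    unfolding agree_def using n(1,3) by (meson le_less_trans not_le)
  finally show ?thesis .
qed

lemma openin_symb_topology:
  "openin (symb_topology Z) U \<longleftrightarrow> U \<subseteq> Z \<and> (\<forall>x\<in>U. \<exists>m. \<forall>y\<in>Z. agree m x y \<longrightarrow> y \<in> U)"
proof -
  interpret Metric_space Z symb_dist by (rule Metric_space_symb_dist)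
  have "(\<exists>r>0. mball x r \<subseteq> U) \<longleftrightarrow> (\<exists>m. \<forall>y\<in>Z. agree m x y \<longrightarrow> y \<in> U)"
    if U: "U \<subseteq> Z" "x \<in> U" for x
  proof
    assume "\<exists>r>0. mball x r \<subseteq> U"
    then obtain r where r: "r > 0" "mball x r \<subseteq> U" by blast
    have "(\<lambda>m. exp (- real m)) \<longlonglongrightarrow> 0"
      by (intro filterlim_compose[OF exp_at_bot] filterlim_compose[OF filterlim_uminus_at_bot_at_top]
          filterlim_real_sequentially)
    then have "\<forall>\<^sub>F m in sequentially. exp (- real m) < r"
      using r(1) order_tendstoD(2) by blast
    then obtain m where m: "exp (- real m) < r"
      by (auto simp: eventually_sequentially)
    have "y \<in> U" if "y \<in> Z" "agree m x y" for y
      using r(2) that m U symb_dist_less_iff_agree[of x y m] by (fastforce simp: mball_def)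
    then show "\<exists>m. \<forall>y\<in>Z. agree m x y \<longrightarrow> y \<in> U" by blast
  next
    assume "\<exists>m. \<forall>y\<in>Z. agree m x y \<longrightarrow> y \<in> U"
    then obtain m where m: "\<And>y. y \<in> Z \<Longrightarrow> agree m x y \<Longrightarrow> y \<in> U" by blast
    then show "\<exists>r>0. mball x r \<subseteq> U"
      by (intro exI[of _ "exp (- real m)"]) (auto simp: symb_dist_less_iff_agree)
  qed
  then show ?thesis unfolding openin_mtopology by blast
qed

lemma topspace_symb_topology [simp]: "topspace (symb_topology Z) = Z"
  by (simp add: Metric_space.topspace_mtopology[OF Metric_space_symb_dist])

lemma symb_topology_subtopology: "symb_topology Z = subtopology (symb_topology UNIV) Z"
proof -
  interpret Submetric UNIV symb_dist Z
    by (simp add: Metric_space_symb_dist Submetric_axioms_def Submetric_def)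
  show ?thesis by (rule mtopology_submetric)
qed

lemma compactin_symb_topology_iff:
  "compactin (symb_topology Z) K \<longleftrightarrow> compactin (symb_topology UNIV) K \<and> K \<subseteq> Z"
  by (subst symb_topology_subtopology) (rule compactin_subtopology)

lemma openin_agree: "openin (symb_topology Z) {y \<in> Z. agree m x y}"
  unfolding openin_symb_topology using agree_trans by blast

lemma openin_coordinate: "openin (symb_topology Z) {y \<in> Z. y n \<in> B}"
  unfolding openin_symb_topology agree_def
  by (auto intro!: exI[of _ "nat \<bar>n\<bar>"])

lemma continuous_map_symb_topologyI:
  assumes "f ` Z \<subseteq> Z'" and "\<And>x m. x \<in> Z \<Longrightarrow> \<exists>k. \<forall>y\<in>Z. agree k x y \<longrightarrow> agree m (f x) (f y)"
  shows "continuous_map (symb_topology Z) (symb_topology Z') f"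
  unfolding continuous_map_def openin_symb_topology
proof (intro conjI allI impI)
  fix U assume U: "U \<subseteq> Z' \<and> (\<forall>x\<in>U. \<exists>m. \<forall>y\<in>Z'. agree m x y \<longrightarrow> y \<in> U)"
  show "\<forall>x\<in>{x \<in> topspace (symb_topology Z). f x \<in> U}. \<exists>m. \<forall>y\<in>Z. agree m x y \<longrightarrow>
      y \<in> {x \<in> topspace (symb_topology Z). f x \<in> U}"
  proof (intro ballI)
    fix x assume x: "x \<in> {x \<in> topspace (symb_topology Z). f x \<in> U}"
    then obtain m where m: "\<And>y. y \<in> Z' \<Longrightarrow> agree m (f x) y \<Longrightarrow> y \<in> U" using U by blast
    obtain k where "\<And>y. y \<in> Z \<Longrightarrow> agree k x y \<Longrightarrow> agree m (f x) (f y)" using assms(2)[of x m] x by auto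
    with m assms(1) show "\<exists>m. \<forall>y\<in>Z. agree m x y \<longrightarrow> y \<in> {x \<in> topspace (symb_topology Z). f x \<in> U}"
      by (intro exI[of _ k]) auto
  qed
qed (use assms(1) in auto)

lemma compactin_imp_finite_coordinate:
  assumes "compactin (symb_topology Z) K"
  shows "finite ((\<lambda>x. x n) ` K)"
proof -
  have "continuous_map (symb_topology Z) (discrete_topology UNIV) (\<lambda>x. x n)"
    unfolding continuous_map_def using openin_coordinate[of Z n] by auto
  from image_compactin[OF assms this] show ?thesis
    by (simp add: compactin_discrete_topology)
qed

lemma compactin_imp_closed:
  assumes "compactin (symb_topology Z) K" and "\<And>m. \<exists>y\<in>K. agree m x y"
  shows "x \<in> K"
proof -
  have "compactin (symb_topology UNIV) K"
    using assms(1) compactin_symb_topology_iff[of Z] by blast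
  then have "closedin (symb_topology UNIV) K"
    by (simp add: compactin_imp_closedin Metric_space.Hausdorff_space_mtopology Metric_space_symb_dist)
  then have "openin (symb_topology UNIV) (- K)"
    by (simp add: closedin_def Compl_eq_Diff_UNIV)
  with assms(2) show ?thesis unfolding openin_symb_topology by blast
qed

lemma continuous_map_product_to_symb:
  "continuous_map (product_topology (\<lambda>_. discrete_topology UNIV) UNIV) (symb_topology UNIV) (\<lambda>x. x)"
  unfolding continuous_map_def
proof (intro conjI allI impI)
  fix U :: "(int \<Rightarrow> 'a) set" assume U: "openin (symb_topology UNIV) U"
  show "openin (product_topology (\<lambda>_. discrete_topology UNIV) UNIV)
      {x \<in> topspace (product_topology (\<lambda>_. discrete_topology UNIV) UNIV). x \<in> U}"
    unfolding openin_product_topology_alt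
  proof (clarsimp)
    fix x assume "x \<in> U"
    then obtain m where m: "\<And>y. agree m x y \<Longrightarrow> y \<in> U"
      using U unfolding openin_symb_topology by blast
    define W where "W = (\<lambda>i. if \<bar>i\<bar> \<le> int m then {x i} else UNIV)"
    have "{i. W i \<noteq> UNIV} \<subseteq> {- int m..int m}" by (auto simp: W_def)
    then have "finite {i. W i \<noteq> UNIV}" by (rule finite_subset) simp
    moreover have "x \<in> Pi\<^sub>E UNIV W" by (auto simp: W_def)
    moreover have "Pi\<^sub>E UNIV W \<subseteq> U"
      using m by (force simp: W_def agree_def PiE_iff split: if_splits)
    ultimately show "\<exists>Ua. finite {i. Ua i \<noteq> UNIV} \<and> x \<in> Pi\<^sub>E UNIV Ua \<and> Pi\<^sub>E UNIV Ua \<subseteq> U"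
      by blast
  qed
qed auto

lemma compactin_symb_topologyI:
  assumes "K \<subseteq> Z" and fin: "\<And>n. finite ((\<lambda>x. x n) ` K)"
    and closed: "\<And>x. (\<And>m. \<exists>y\<in>K. agree m x y) \<Longrightarrow> x \<in> K"
  shows "compactin (symb_topology Z) K"
proof -
  define P where "P = Pi\<^sub>E UNIV (\<lambda>n. (\<lambda>x. x n) ` K)"
  have "compactin (product_topology (\<lambda>_. discrete_topology UNIV) UNIV) P"
    unfolding P_def compactin_PiE by (simp add: compactin_discrete_topology fin)
  from image_compactin[OF this continuous_map_product_to_symb]
  have P: "compactin (symb_topology UNIV) P" by simp
  have "openin (symb_topology UNIV) (- K)"
    unfolding openin_symb_topology using closed by blast
  then have "closedin (symb_topology UNIV) K"
    by (simp add: closedin_def Compl_eq_Diff_UNIV)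
  moreover have "K \<subseteq> P" by (auto simp: P_def)
  ultimately have "compactin (symb_topology UNIV) K"
    using P closed_compactin by blast
  then show ?thesis
    using assms(1) compactin_symb_topology_iff[of Z] by blast
qed

definition cylinder_algebra :: "(int \<Rightarrow> 'a) measure"
  where "cylinder_algebra = sigma UNIV (range (\<lambda>(n, a). {x. x n = a}))"

lemma space_cylinder_algebra [simp]: "space cylinder_algebra = UNIV"
  by (simp add: cylinder_algebra_def)

lemma sets_cylinder_algebra:
  "sets cylinder_algebra = sigma_sets UNIV (range (\<lambda>(n, a). {x. x n = a}))"
  by (simp add: cylinder_algebra_def)

lemma UNIV_cylinder_algebra [simp]: "UNIV \<in> sets cylinder_algebra"
  by (metis sets.top space_cylinder_algebra)

lemma cylinder_in_sets [measurable]: "{x. x n = a} \<in> sets cylinder_algebra"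
  unfolding sets_cylinder_algebra by (rule sigma_sets.Basic) auto

lemma space_borel_of [simp]: "space (borel_of T) = topspace T"
  by (simp add: borel_of_def space_measure_of_conv)

lemma sets_borel_of: "sets (borel_of T) = sigma_sets (topspace T) {U. openin T U}"
  unfolding borel_of_def by (rule sets_measure_of) (auto dest: openin_subset)

lemma openin_imp_sets_borel_of: "openin T U \<Longrightarrow> U \<in> sets (borel_of T)"
  by (simp add: sets_borel_of sigma_sets.Basic)

lemma openin_symb_eq_cylinder:
  assumes "countable V" "Z \<subseteq> {x. range x \<subseteq> V}" "openin (symb_topology Z) U"
  shows "\<exists>C\<in>sets cylinder_algebra. U = Z \<inter> C"
proof -
  let ?W = "SIGMA m:(UNIV::nat set). Pi\<^sub>E {- int m..int m} (\<lambda>_. V)"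
  define cyl where "cyl = (\<lambda>(m, w). {x. \<forall>n\<in>{- int m..int m}. x n = w n} :: (int \<Rightarrow> 'a) set)"
  have cyl: "cyl p \<in> sets cylinder_algebra" for p
  proof -
    have "cyl p = (\<Inter>n\<in>{- int (fst p)..int (fst p)}. {x. x n = snd p n})"
      by (auto simp: cyl_def split: prod.splits)
    also have "\<dots> \<in> sets cylinder_algebra" by (intro sets.finite_INT) auto
    finally show ?thesis .
  qed
  define I where "I = {p \<in> ?W. Z \<inter> cyl p \<subseteq> U}"
  have "countable ?W" using assms(1) by (intro countable_SIGMA countable_PiE) auto
  then have I: "countable I" unfolding I_def by (rule countable_subset[rotated]) auto
  have "U = Z \<inter> (\<Union>p\<in>I. cyl p)"
  proof
    show "U \<subseteq> Z \<inter> (\<Union>p\<in>I. cyl p)"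
    proof
      fix x assume x: "x \<in> U"
      then obtain m where m: "\<And>y. y \<in> Z \<Longrightarrow> agree m x y \<Longrightarrow> y \<in> U"
        using assms(3) unfolding openin_symb_topology by blast
      let ?p = "(m, restrict x {- int m..int m})"
      have "x \<in> Z" using x assms(3) openin_subset by fastforce
      then have xV: "x n \<in> V" for n using assms(2) by auto
      have "x \<in> Z" by fact
      moreover have "x \<in> cyl ?p" by (auto simp: cyl_def)
      moreover have "?p \<in> I"
        using m \<open>x \<in> Z\<close> xV unfolding I_def cyl_def agree_def
        by (auto simp: PiE_iff abs_le_iff)
      ultimately show "x \<in> Z \<inter> (\<Union>p\<in>I. cyl p)" by blast
    qed
  qed (auto simp: I_def)
  moreover have "(\<Union>p\<in>I. cyl p) \<in> sets cylinder_algebra"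
    using I cyl by (intro sets.countable_UN'') auto
  ultimately show ?thesis by blast
qed

lemma sets_borel_of_symb_topology:
  assumes "countable V" "Z \<subseteq> {x. range x \<subseteq> V}"
  shows "sets (borel_of (symb_topology Z)) = sets (restrict_space cylinder_algebra Z)"
proof
  show "sets (borel_of (symb_topology Z)) \<subseteq> sets (restrict_space cylinder_algebra Z)"
    unfolding sets_borel_of
  proof (rule sets.sigma_sets_subset')
    show "{U. openin (symb_topology Z) U} \<subseteq> sets (restrict_space cylinder_algebra Z)"
      using openin_symb_eq_cylinder[OF assms] by (fastforce simp: sets_restrict_space)
    show "topspace (symb_topology Z) \<in> sets (restrict_space cylinder_algebra Z)"
      by (auto simp: sets_restrict_space image_iff intro!: bexI[of _ UNIV])
  qed
  have "Z \<inter> C \<in> sets (borel_of (symb_topology Z))" if "C \<in> sets cylinder_algebra" for C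
    using that unfolding sets_cylinder_algebra
  proof (induction rule: sigma_sets.induct)
    case (Basic a)
    then obtain n b where "a = {x. x n = b}" by auto
    then have "Z \<inter> a = {x \<in> Z. x n \<in> {b}}" by auto
    then show ?case using openin_imp_sets_borel_of openin_coordinate by metis
  next
    case (Compl a)
    have "Z \<inter> (UNIV - a) = space (borel_of (symb_topology Z)) - (Z \<inter> a)" by auto
    then show ?case using Compl.IH by (metis sets.compl_sets)
  next
    case (Union a)
    then show ?case by (metis Int_UN_distrib sets.countable_UN image_subset_iff)
  qed simp
  then show "sets (restrict_space cylinder_algebra Z) \<subseteq> sets (borel_of (symb_topology Z))"
    by (auto simp: sets_restrict_space)
qed

lemma markov_shift_range: "E \<subseteq> V \<times> V \<Longrightarrow> x \<in> markov_shift E \<Longrightarrow> x n \<in> V"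
  unfolding markov_shift_def by blast

lemma markov_shift_in_sets:
  assumes "countable E"
  shows "markov_shift E \<in> sets cylinder_algebra"
proof -
  have "markov_shift E = (\<Inter>n. \<Union>(a, b)\<in>E. {x. x n = a} \<inter> {x. x (n + 1) = b})"
    by (auto simp: markov_shift_def)
  also have "\<dots> \<in> sets cylinder_algebra"
    using assms by (intro sets.countable_INT'' sets.countable_UN'') (auto split: prod.splits)
  finally show ?thesis .
qed

lemma regular_part_in_sets:
  assumes "countable V" "X \<in> sets cylinder_algebra"
  shows "regular_part V X \<in> sets cylinder_algebra"
proof -
  have "regular_part V X = X \<inter> (\<Union>u\<in>V. \<Union>v\<in>V. (\<Inter>m. \<Union>n\<in>{m..}. {x. x (- int n) = u}) \<inter>
      (\<Inter>m. \<Union>n\<in>{m..}. {x. x (int n) = v}))"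
    by (rule set_eqI)
      (simp only: regular_part_def infinite_nat_iff_unbounded_le mem_Collect_eq Int_iff UN_iff INT_iff
        atLeast_iff, blast)
  also have "\<dots> \<in> sets cylinder_algebra"
    using assms by (intro sets.Int sets.countable_UN'' sets.countable_INT'') auto
  finally show ?thesis .
qed

section \<open>Measurability of projections\<close>

text \<open>The sets \<open>H s\<close> are measurable hulls of the pieces of the Souslin set determined by the finite
  words \<open>s\<close>; up to null sets each hull is covered by the hulls of its children, so almost every point
  of the hull of the whole set descends along an infinite branch.\<close>

lemma souslin_set_in_completion:
  fixes G :: "nat \<Rightarrow> (nat \<Rightarrow> nat) \<Rightarrow> 'y set"
  assumes "finite_measure M"
    and G: "\<And>j \<tau>. G j \<tau> \<in> sets M"
    and loc: "\<And>j \<tau>. \<exists>m. \<forall>\<tau>'. (\<forall>k<m. \<tau>' k = \<tau> k) \<longrightarrow> G j \<tau>' = G j \<tau>"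
  shows "{y. \<exists>\<tau>. \<forall>j. y \<in> G j \<tau>} \<in> sets (completion M)"
proof -
  interpret finite_measure M by fact
  define ext where "ext = (\<lambda>(s :: nat list) \<tau>. \<forall>i<length s. \<tau> i = s ! i)"
  define S where "S = (\<lambda>s. {y. \<exists>\<tau>. ext s \<tau> \<and> (\<forall>j. y \<in> G j \<tau>)})"
  define det where "det = (\<lambda>s j. \<forall>\<tau> \<tau>'. ext s \<tau> \<longrightarrow> ext s \<tau>' \<longrightarrow> G j \<tau> = G j \<tau>')"
  define pt where "pt = (\<lambda>s i. if i < length s then s ! i else 0 :: nat)"
  have ext_pt: "ext s (pt s)" for s by (simp add: ext_def pt_def)
  have S_space: "S s \<subseteq> space M" for s
    using G sets.sets_into_space unfolding S_def by blast
  have "\<exists>H0. measurable_envelope M (S s) H0" for s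
    using measurable_envelopeI_countable_cover[of "S s" "\<lambda>_. space M" M] S_space[of s]
    by (auto simp: less_top[symmetric])
  then obtain H0 where H0: "\<And>s. measurable_envelope M (S s) (H0 s)" by metis
  define H where "H = (\<lambda>s. H0 s \<inter> {y \<in> space M. \<forall>j\<in>{j. det s j}. y \<in> G j (pt s)})"
  have H_sets: "H s \<in> sets M" for s
  proof -
    have "{y \<in> space M. y \<in> G j (pt s)} = space M \<inter> G j (pt s)" for j by blast
    then have "{y \<in> space M. y \<in> G j (pt s)} \<in> sets M" for j using G by auto
    then show ?thesis
      unfolding H_def using measurable_envelopeD(2)[OF H0]
      by (intro sets.Int sets.sets_Collect_countable_Ball) auto
  qed
  have S_H: "S s \<subseteq> H s" for s
  proof
    fix y assume y: "y \<in> S s"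
    then obtain \<tau> where \<tau>: "ext s \<tau>" "\<And>j. y \<in> G j \<tau>" unfolding S_def by blast
    have "y \<in> G j (pt s)" if "det s j" for j
      using that \<tau> ext_pt[of s] unfolding det_def by blast
    then show "y \<in> H s"
      using y S_space[of s] measurable_envelopeD(1)[OF H0, of s] unfolding H_def by blast
  qed
  have S_step: "S s \<subseteq> (\<Union>k. S (s @ [k]))" for s
  proof
    fix y assume "y \<in> S s"
    then obtain \<tau> where \<tau>: "ext s \<tau>" "\<And>j. y \<in> G j \<tau>" unfolding S_def by blast
    then have "ext (s @ [\<tau> (length s)]) \<tau>"
      unfolding ext_def by (simp add: nth_append less_Suc_eq)
    with \<tau>(2) show "y \<in> (\<Union>k. S (s @ [k]))" unfolding S_def by blast
  qed
  define N where "N = (\<lambda>s. H s - (\<Union>k. H (s @ [k])))"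
  have "N s \<in> null_sets M" for s
  proof
    show N: "N s \<in> sets M" unfolding N_def using H_sets by blast
    have "S s \<subseteq> (\<Union>k. H (s @ [k]))"
      by (rule order_trans[OF S_step]) (rule UN_mono[OF order_refl S_H])
    moreover have "H s \<subseteq> H0 s" unfolding H_def by (rule Int_lower1)
    ultimately have "N s \<subseteq> H0 s - S s" unfolding N_def by (auto dest: subsetD)
    with N show "emeasure M (N s) = 0" by (rule measurable_envelopeD1[OF H0])
  qed
  then have null: "(\<Union>s. N s) \<in> null_sets M" by (intro null_sets_UN) auto
  have "H [] - (\<Union>s. N s) \<subseteq> S []"
  proof
    fix y assume y: "y \<in> H [] - (\<Union>s. N s)"
    have "\<exists>k. y \<in> H (s @ [k])" if "y \<in> H s" for s
      using that y unfolding N_def by blast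
    then obtain k where k: "\<And>s. y \<in> H s \<Longrightarrow> y \<in> H (s @ [k s])" by metis
    define w where "w = rec_nat [] (\<lambda>_ s. s @ [k s])"
    have w: "w 0 = []" "\<And>n. w (Suc n) = w n @ [k (w n)]" by (simp_all add: w_def)
    have len: "length (w n) = n" for n by (induction n) (auto simp: w)
    have yw: "y \<in> H (w n)" for n using y by (induction n) (auto simp: w k)
    define \<tau> where "\<tau> = (\<lambda>i. k (w i))"
    have "w n ! i = \<tau> i" if "i < n" for n i
      using that by (induction n) (auto simp: w nth_append len less_Suc_eq \<tau>_def)
    then have ext_w: "ext (w n) \<tau>" for n by (simp add: ext_def len)
    have "y \<in> G j \<tau>" for j
    proof -
      obtain m where m: "\<And>\<tau>'. (\<forall>k<m. \<tau>' k = \<tau> k) \<Longrightarrow> G j \<tau>' = G j \<tau>" using loc[of \<tau> j] by blast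
      have eq: "G j \<tau>' = G j \<tau>" if "ext (w m) \<tau>'" for \<tau>'
        using that ext_w[of m] m[of \<tau>'] by (simp add: ext_def len)
      then have "det (w m) j" unfolding det_def by metis
      then have "y \<in> G j (pt (w m))" using yw[of m] unfolding H_def by blast
      then show ?thesis using eq[OF ext_pt] by simp
    qed
    then show "y \<in> S []" unfolding S_def by (auto simp: ext_def)
  qed
  then have "S [] = (H [] - (\<Union>s. N s)) \<union> (S [] \<inter> (\<Union>s. N s))"
    using S_H[of "[]"] by blast
  then have "S [] \<in> sets (completion M)"
    using null H_sets[of "[]"]
    by (intro sets_completionI[of "S []" "H [] - (\<Union>s. N s)" "S [] \<inter> (\<Union>s. N s)" "\<Union>s. N s"]) auto
  then show ?thesis by (simp add: S_def ext_def)
qed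

definition souslin_scheme ::
    "'y measure \<Rightarrow> ((nat \<Rightarrow> nat) \<times> 'y) set \<Rightarrow> (nat \<Rightarrow> (nat \<Rightarrow> nat) \<Rightarrow> (nat \<Rightarrow> nat) \<Rightarrow> 'y set) \<Rightarrow> bool"
  where "souslin_scheme M A G \<longleftrightarrow>
    (\<forall>j u \<sigma>. G j u \<sigma> \<in> sets M) \<and>
    (\<forall>j u \<sigma>. \<exists>m. \<forall>u' \<sigma>'. (\<forall>k<m. u' k = u k \<and> \<sigma>' k = \<sigma> k) \<longrightarrow> G j u' \<sigma>' = G j u \<sigma>) \<and>
    (\<forall>u y. (u, y) \<in> A \<longleftrightarrow> (\<exists>\<sigma>. \<forall>j. y \<in> G j u \<sigma>))"

definition souslin_rel :: "'y measure \<Rightarrow> ((nat \<Rightarrow> nat) \<times> 'y) set \<Rightarrow> bool"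
  where "souslin_rel M A \<longleftrightarrow> (\<exists>G. souslin_scheme M A G)"

lemma souslin_schemeD:
  assumes "souslin_scheme M A G"
  shows "G j u \<sigma> \<in> sets M"
    and "\<exists>m. \<forall>u' \<sigma>'. (\<forall>k<m. u' k = u k \<and> \<sigma>' k = \<sigma> k) \<longrightarrow> G j u' \<sigma>' = G j u \<sigma>"
    and "(u, y) \<in> A \<longleftrightarrow> (\<exists>\<sigma>. \<forall>j. y \<in> G j u \<sigma>)"
  using assms unfolding souslin_scheme_def by simp_all

lemma souslin_rel_Times:
  assumes "\<And>u. \<exists>m. \<forall>u'. (\<forall>k<m. u' k = u k) \<longrightarrow> (u' \<in> U \<longleftrightarrow> u \<in> U)" and "B \<in> sets M"
  shows "souslin_rel M (U \<times> B)"
proof -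
  have "\<exists>m. \<forall>u' \<sigma>'. (\<forall>k<m. u' k = u k \<and> \<sigma>' k = \<sigma> k) \<longrightarrow>
      (if u' \<in> U then B else {}) = (if u \<in> U then B else {})" for u \<sigma> :: "nat \<Rightarrow> nat"
    using assms(1)[of u] by metis
  then show ?thesis
    unfolding souslin_rel_def souslin_scheme_def using assms(2)
    by (intro exI[of _ "\<lambda>j u \<sigma>. if u \<in> U then B else {}"] conjI allI) auto
qed

lemma souslin_rel_INT:
  assumes "\<And>i::nat. souslin_rel M (A i)"
  shows "souslin_rel M (\<Inter>i. A i)"
proof -
  obtain G where "\<And>i. souslin_scheme M (A i) (G i)"
    using assms unfolding souslin_rel_def by metis
  note G = souslin_schemeD(1)[OF this] and loc = souslin_schemeD(2)[OF this]
    and A = souslin_schemeD(3)[OF this]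
  define part where "part = (\<lambda>i \<sigma> k. \<sigma> (prod_encode (i, k)) :: nat)"
  define F where "F = (\<lambda>n u \<sigma>. case prod_decode n of (i, j) \<Rightarrow> G i j u (part i \<sigma>))"
  have "\<exists>m. \<forall>u' \<sigma>'. (\<forall>k<m. u' k = u k \<and> \<sigma>' k = \<sigma> k) \<longrightarrow> F n u' \<sigma>' = F n u \<sigma>" for n u \<sigma>
  proof -
    obtain i j where ij: "prod_decode n = (i, j)" by fastforce
    obtain m where m: "\<And>u' \<sigma>'. (\<forall>k<m. u' k = u k \<and> \<sigma>' k = part i \<sigma> k) \<Longrightarrow>
        G i j u' \<sigma>' = G i j u (part i \<sigma>)"
      using loc[where u = u and \<sigma> = "part i \<sigma>" and j = j] by blast
    define m' where "m' = Suc (Max (insert m ((\<lambda>k. prod_encode (i, k)) ` {..<m})))"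
    have "k < m'" if "k < m" for k
      using that unfolding m'_def by (meson Max_ge finite.insertI finite_imageI finite_lessThan insertI1 less_Suc_eq_le less_imp_le_nat order_trans)
    moreover have "prod_encode (i, k) < m'" if "k < m" for k
      using that unfolding m'_def less_Suc_eq_le by (intro Max_ge) auto
    ultimately have "F n u' \<sigma>' = F n u \<sigma>" if "\<forall>k<m'. u' k = u k \<and> \<sigma>' k = \<sigma> k" for u' \<sigma>'
      using that m[of u' "part i \<sigma>'"] unfolding F_def ij by (simp add: part_def)
    then show ?thesis by blast
  qed
  moreover have "(u, y) \<in> (\<Inter>i. A i) \<longleftrightarrow> (\<exists>\<sigma>. \<forall>n. y \<in> F n u \<sigma>)" for u y
  proof
    assume "(u, y) \<in> (\<Inter>i. A i)"
    then have "\<forall>i. \<exists>\<sigma>. \<forall>j. y \<in> G i j u \<sigma>" using A by blast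
    then obtain \<sigma> where \<sigma>: "\<And>i j. y \<in> G i j u (\<sigma> i)" by metis
    define \<rho> where "\<rho> = (\<lambda>n. case prod_decode n of (i, k) \<Rightarrow> \<sigma> i k)"
    have "part i \<rho> = \<sigma> i" for i by (auto simp: part_def \<rho>_def)
    then have "\<forall>n. y \<in> F n u \<rho>" using \<sigma> by (auto simp: F_def split: prod.splits)
    then show "\<exists>\<sigma>. \<forall>n. y \<in> F n u \<sigma>" by blast
  next
    assume "\<exists>\<sigma>. \<forall>n. y \<in> F n u \<sigma>"
    then obtain \<rho> where y: "\<And>n. y \<in> F n u \<rho>" by blast
    have "y \<in> G i j u (part i \<rho>)" for i j using y[of "prod_encode (i, j)"] by (simp add: F_def)
    then show "(u, y) \<in> (\<Inter>i. A i)" using A by blast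
  qed
  moreover have "F n u \<sigma> \<in> sets M" for n u \<sigma> using G by (auto simp: F_def split: prod.splits)
  ultimately have "souslin_scheme M (\<Inter> i. A i) F" unfolding souslin_scheme_def by blast
  then show ?thesis unfolding souslin_rel_def by blast
qed

lemma souslin_rel_UN:
  assumes "\<And>i::nat. souslin_rel M (A i)"
  shows "souslin_rel M (\<Union>i. A i)"
proof -
  obtain G where "\<And>i. souslin_scheme M (A i) (G i)"
    using assms unfolding souslin_rel_def by metis
  note G = souslin_schemeD(1)[OF this] and loc = souslin_schemeD(2)[OF this]
    and A = souslin_schemeD(3)[OF this]
  define F where "F = (\<lambda>j u \<sigma>. G (\<sigma> 0) j u (\<lambda>k. \<sigma> (Suc k)))"
  have "\<exists>m. \<forall>u' \<sigma>'. (\<forall>k<m. u' k = u k \<and> \<sigma>' k = \<sigma> k) \<longrightarrow> F j u' \<sigma>' = F j u \<sigma>" for j u \<sigma>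
  proof -
    obtain m where m: "\<And>u' \<sigma>'. (\<forall>k<m. u' k = u k \<and> \<sigma>' k = \<sigma> (Suc k)) \<Longrightarrow>
        G (\<sigma> 0) j u' \<sigma>' = F j u \<sigma>"
      using loc[where u = u and \<sigma> = "\<lambda>k. \<sigma> (Suc k)" and j = j] unfolding F_def by blast
    have "F j u' \<sigma>' = F j u \<sigma>" if "\<forall>k<Suc m. u' k = u k \<and> \<sigma>' k = \<sigma> k" for u' \<sigma>'
    proof -
      have "G (\<sigma> 0) j u' (\<lambda>k. \<sigma>' (Suc k)) = F j u \<sigma>" by (rule m) (use that in auto)
      moreover have "\<sigma>' 0 = \<sigma> 0" using that by blast
      ultimately show ?thesis by (simp add: F_def)
    qed
    then show ?thesis by blast
  qed
  moreover have "(u, y) \<in> (\<Union>i. A i) \<longleftrightarrow> (\<exists>\<sigma>. \<forall>n. y \<in> F n u \<sigma>)" for u y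
  proof
    assume "(u, y) \<in> (\<Union>i. A i)"
    then obtain i \<sigma> where y: "\<And>j. y \<in> G i j u \<sigma>" using A by blast
    have "\<forall>n. y \<in> F n u (\<lambda>k. case k of 0 \<Rightarrow> i | Suc k \<Rightarrow> \<sigma> k)" using y by (simp add: F_def)
    then show "\<exists>\<sigma>. \<forall>n. y \<in> F n u \<sigma>" by blast
  next
    assume "\<exists>\<sigma>. \<forall>n. y \<in> F n u \<sigma>"
    then show "(u, y) \<in> (\<Union>i. A i)" using A unfolding F_def by blast
  qed
  moreover have "F n u \<sigma> \<in> sets M" for n u \<sigma> using G by (auto simp: F_def)
  ultimately have "souslin_scheme M (\<Union> i. A i) F" unfolding souslin_scheme_def by blast
  then show ?thesis unfolding souslin_rel_def by blast
qed

lemma souslin_rel_Un: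
  assumes "souslin_rel M A" "souslin_rel M B"
  shows "souslin_rel M (A \<union> B)"
proof -
  have "A \<union> B = (\<Union>i::nat. if i = 0 then A else B)" by (auto split: if_splits)
  then show ?thesis using souslin_rel_UN[of M "\<lambda>i. if i = 0 then A else B"] assms by auto
qed

lemma souslin_rel_Int:
  assumes "souslin_rel M A" "souslin_rel M B"
  shows "souslin_rel M (A \<inter> B)"
proof -
  have "A \<inter> B = (\<Inter>i::nat. if i = 0 then A else B)" by (auto split: if_splits)
  then show ?thesis using souslin_rel_INT[of M "\<lambda>i. if i = 0 then A else B"] assms by auto
qed

lemma souslin_rel_projection:
  assumes "finite_measure M" "souslin_rel M A"
  shows "snd ` A \<in> sets (completion M)"
proof -
  obtain G where "souslin_scheme M A G"
    using assms(2) unfolding souslin_rel_def by blast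
  note G = souslin_schemeD(1)[OF this] and loc = souslin_schemeD(2)[OF this]
    and A = souslin_schemeD(3)[OF this]
  define F where "F = (\<lambda>j \<tau>. G j (\<lambda>k. \<tau> (2 * k)) (\<lambda>k. \<tau> (2 * k + 1)))"
  have "\<exists>m. \<forall>\<tau>'. (\<forall>k<m. \<tau>' k = \<tau> k) \<longrightarrow> F j \<tau>' = F j \<tau>" for j \<tau>
  proof -
    obtain m where m: "\<And>u' \<sigma>'. (\<forall>k<m. u' k = \<tau> (2 * k) \<and> \<sigma>' k = \<tau> (2 * k + 1)) \<Longrightarrow>
        G j u' \<sigma>' = F j \<tau>"
      using loc[where u = "\<lambda>k. \<tau> (2 * k)" and \<sigma> = "\<lambda>k. \<tau> (2 * k + 1)" and j = j]
      unfolding F_def by blast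
    have "F j \<tau>' = F j \<tau>" if "\<forall>k<2 * m. \<tau>' k = \<tau> k" for \<tau>'
      using m[of "\<lambda>k. \<tau>' (2 * k)" "\<lambda>k. \<tau>' (2 * k + 1)"] that by (simp add: F_def)
    then show ?thesis by blast
  qed
  then have "{y. \<exists>\<tau>. \<forall>j. y \<in> F j \<tau>} \<in> sets (completion M)"
    using G by (intro souslin_set_in_completion[OF assms(1)]) (auto simp: F_def)
  also have "{y. \<exists>\<tau>. \<forall>j. y \<in> F j \<tau>} = snd ` A"
  proof (intro set_eqI iffI)
    fix y assume "y \<in> snd ` A"
    then obtain u where "(u, y) \<in> A" by auto
    then obtain \<sigma> where y: "\<And>j. y \<in> G j u \<sigma>" using A by blast
    have "\<forall>j. y \<in> F j (\<lambda>k. if even k then u (k div 2) else \<sigma> (k div 2))"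
      using y by (simp add: F_def)
    then show "y \<in> {y. \<exists>\<tau>. \<forall>j. y \<in> F j \<tau>}" by blast
  next
    fix y assume "y \<in> {y. \<exists>\<tau>. \<forall>j. y \<in> F j \<tau>}"
    then obtain u where "(u, y) \<in> A" using A unfolding F_def by blast
    then show "y \<in> snd ` A" by force
  qed
  finally show ?thesis .
qed

lemma souslin_rel_decode:
  assumes "C \<in> sets cylinder_algebra" and "B \<in> sets M"
    and dec: "dec = (\<lambda>u n. e (u (f n)))"
  shows "souslin_rel M ((dec -` C) \<times> B)"
proof -
  have "souslin_rel M ((dec -` C) \<times> B) \<and> souslin_rel M ((dec -` (- C)) \<times> B)"
    using assms(1) unfolding sets_cylinder_algebra
  proof (induction rule: sigma_sets.induct)
    case (Basic C)
    then obtain n a where C: "C = {x. x n = a}" by auto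
    have "\<exists>m. \<forall>u'. (\<forall>k<m. u' k = u k) \<longrightarrow> (u' \<in> dec -` C \<longleftrightarrow> u \<in> dec -` C)"
      "\<exists>m. \<forall>u'. (\<forall>k<m. u' k = u k) \<longrightarrow> (u' \<in> dec -` (- C) \<longleftrightarrow> u \<in> dec -` (- C))" for u
      by (auto simp: C dec intro!: exI[of _ "Suc (f n)"])
    with assms(2) show ?case by (intro conjI souslin_rel_Times)
  next
    case Empty
    show ?case using assms(2) by (intro conjI souslin_rel_Times) auto
  next
    case (Compl C)
    then show ?case by (simp add: Compl_eq_Diff_UNIV[symmetric])
  next
    case (Union C)
    have "dec -` (\<Union>i. C i) \<times> B = (\<Union>i. dec -` C i \<times> B)"
      "dec -` (- (\<Union>i. C i)) \<times> B = (\<Inter>i. dec -` (- C i) \<times> B)" by auto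
    with Union.IH show ?case by (simp add: souslin_rel_UN souslin_rel_INT)
  qed
  then show ?thesis by blast
qed

lemma standard_borel_separating_sequence:
  assumes "standard_borel Y"
  obtains B :: "nat \<Rightarrow> 'y set" where "\<And>i. B i \<in> sets Y"
    and "\<And>y y'. y \<in> space Y \<Longrightarrow> y' \<in> space Y \<Longrightarrow> (\<And>i. y \<in> B i \<longleftrightarrow> y' \<in> B i) \<Longrightarrow> y = y'"
proof -
  obtain \<tau> where \<tau>: "completely_metrizable_space \<tau>" "second_countable \<tau>"
      "space Y = topspace \<tau>" "sets Y = sets (borel_of \<tau>)"
    using assms unfolding standard_borel_def by blast
  obtain \<B> where "countable \<B> \<and> (\<forall>W\<in>\<B>. openin \<tau> W) \<and>
      (\<forall>U x. openin \<tau> U \<and> x \<in> U \<longrightarrow> (\<exists>W\<in>\<B>. x \<in> W \<and> W \<subseteq> U))"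
    using \<tau>(2) unfolding second_countable_def by (rule exE)
  then have \<B>: "countable \<B>" "\<And>W. W \<in> \<B> \<Longrightarrow> openin \<tau> W"
      "\<And>U x. openin \<tau> U \<Longrightarrow> x \<in> U \<Longrightarrow> \<exists>W\<in>\<B>. x \<in> W \<and> W \<subseteq> U"
    by simp_all
  have H: "Hausdorff_space \<tau>"
    using \<tau>(1) completely_metrizable_imp_metrizable_space metrizable_imp_Hausdorff_space by blast
  define B where "B = from_nat_into (insert {} \<B>)"
  have range_B: "range B = insert {} \<B>"
    unfolding B_def using \<B>(1) by (intro range_from_nat_into) auto
  show thesis
  proof (rule that)
    show "B i \<in> sets Y" for i
    proof -
      have "B i \<in> insert {} \<B>" using range_B by blast
      then show ?thesis using \<B>(2) \<tau>(4) openin_imp_sets_borel_of by auto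
    qed
    fix y y' assume y: "y \<in> space Y" "y' \<in> space Y" and eq: "\<And>i. y \<in> B i \<longleftrightarrow> y' \<in> B i"
    show "y = y'"
    proof (rule ccontr)
      assume "y \<noteq> y'"
      then obtain U where "openin \<tau> U" "y \<in> U" "y' \<notin> U"
        using H y \<tau>(3) unfolding Hausdorff_space_def disjnt_def by (metis IntI empty_iff)
      then obtain W where W: "W \<in> \<B>" "y \<in> W" "y' \<notin> W" using \<B>(3) by blast
      then obtain i where "W = B i" using range_B by blast
      with W eq show False by blast
    qed
  qed
qed

text \<open>The image is the projection of the graph of \<open>p\<close>, which is a Souslin relation because membership
  of \<open>p x\<close> in a separating sequence of sets determines \<open>p x\<close>.\<close>

lemma image_in_completion:
  assumes Y: "standard_borel Y" and V: "countable V" and ZV: "Z \<subseteq> {x. range x \<subseteq> V}"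
    and Z: "Z \<in> sets cylinder_algebra"
    and p: "p \<in> measurable (borel_of (symb_topology Z)) Y"
    and D: "D \<in> sets cylinder_algebra"
    and \<mu>: "finite_measure \<mu>" "sets \<mu> = sets Y"
  shows "p ` (Z \<inter> D) \<in> sets (completion \<mu>)"
proof (cases "V = {}")
  case True
  then have "Z = {}" using ZV by auto
  then show ?thesis by simp
next
  case False
  obtain B where B: "\<And>i::nat. B i \<in> sets Y"
    "\<And>y y'. y \<in> space Y \<Longrightarrow> y' \<in> space Y \<Longrightarrow> (\<And>i. y \<in> B i \<longleftrightarrow> y' \<in> B i) \<Longrightarrow> y = y'"
    using standard_borel_separating_sequence[OF Y] by metis
  have "\<exists>P\<in>sets cylinder_algebra. p -` B i \<inter> Z = Z \<inter> P" for i
    using measurable_sets[OF p B(1)[of i]] sets_borel_of_symb_topology[OF V ZV]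
    by (auto simp: sets_restrict_space)
  then obtain P where P: "\<And>i. P i \<in> sets cylinder_algebra" "\<And>i. p -` B i \<inter> Z = Z \<inter> P i" by metis
  define dec where "dec = (\<lambda>(u :: nat \<Rightarrow> nat) (n :: int). from_nat_into V (u (int_encode n)))"
  have sY: "space \<mu> = space Y" using \<mu>(2) by (rule sets_eq_imp_space_eq)
  have B': "B i \<in> sets \<mu>" "space \<mu> - B i \<in> sets \<mu>" for i
    using B(1) \<mu>(2) by auto
  define A where "A = (dec -` (Z \<inter> D) \<times> space \<mu>) \<inter>
    (\<Inter>i. (dec -` P i \<times> B i) \<union> (dec -` (- P i) \<times> (space \<mu> - B i)))"
  have "- P i \<in> sets cylinder_algebra" for i
    using sets.compl_sets[OF P(1)[of i]] by (simp add: Compl_eq_Diff_UNIV)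
  then have "souslin_rel \<mu> A"
    unfolding A_def using P(1) Z D B'
    by (intro souslin_rel_Int souslin_rel_INT souslin_rel_Un souslin_rel_decode[OF _ _ dec_def]) auto
  then have "snd ` A \<in> sets (completion \<mu>)" by (rule souslin_rel_projection[OF \<mu>(1)])
  also have "snd ` A = p ` (Z \<inter> D)"
  proof (intro set_eqI iffI)
    fix y assume "y \<in> snd ` A"
    then obtain u where u: "(u, y) \<in> A" by auto
    let ?x = "dec u"
    have x: "?x \<in> Z \<inter> D" and y: "y \<in> space Y" using u sY unfolding A_def by auto
    have "p ?x \<in> space Y" using x measurable_space[OF p] by simp
    moreover have "p ?x \<in> B i \<longleftrightarrow> y \<in> B i" for i
    proof -
      have "?x \<in> P i \<longleftrightarrow> y \<in> B i" using u unfolding A_def by auto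
      moreover have "p ?x \<in> B i \<longleftrightarrow> ?x \<in> P i" using P(2)[of i] x by blast
      ultimately show ?thesis by simp
    qed
    ultimately have "p ?x = y" using y B(2) by blast
    with x show "y \<in> p ` (Z \<inter> D)" by blast
  next
    fix y assume "y \<in> p ` (Z \<inter> D)"
    then obtain x where x: "x \<in> Z \<inter> D" "y = p x" by blast
    define u where "u = (\<lambda>k. to_nat_on V (x (int_decode k)))"
    have "x n \<in> V" for n using x(1) ZV by auto
    then have u: "dec u = x" using V by (auto simp: dec_def u_def)
    have "y \<in> space Y" using x measurable_space[OF p] by simp
    moreover have "x \<in> P i \<longleftrightarrow> y \<in> B i" for i using P(2)[of i] x by blast
    ultimately have "(u, y) \<in> A" using x(1) sY unfolding A_def by (auto simp: u)
    then show "y \<in> snd ` A" by force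
  qed
  finally show ?thesis .
qed

section \<open>Recurrence for invertible ergodic systems\<close>

lemma ergodic_recurrence:
  assumes erg: "ergodic_measure Y f \<mu>" and f: "f \<in> measurable Y Y"
    and G: "G \<in> sets Y" "emeasure \<mu> G \<noteq> 0"
  shows "AE y in \<mu>. \<forall>k. \<exists>n\<ge>k. (f ^^ n) y \<in> G"
proof -
  interpret prob_space \<mu> using erg by (simp add: ergodic_measure_def)
  have s: "sets \<mu> = sets Y" using erg by (simp add: ergodic_measure_def)
  have sp: "space \<mu> = space Y" using s by (rule sets_eq_imp_space_eq)
  have inv: "\<And>A. A \<in> sets Y \<Longrightarrow> emeasure \<mu> (f -` A \<inter> space Y) = emeasure \<mu> A"
    and triv: "\<And>A. A \<in> sets Y \<Longrightarrow> f -` A \<inter> space Y = A \<Longrightarrow> emeasure \<mu> A = 0 \<or> emeasure \<mu> A = 1"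
    using erg by (auto simp: ergodic_measure_def)
  have fn: "f ^^ n \<in> measurable Y Y" for n
    by (induction n) (simp_all add: measurable_compose[OF _ f] comp_def)
  define U where "U = (\<lambda>k. \<Union>n\<in>{k..}. (f ^^ n) -` G \<inter> space Y)"
  have U_sets: "U k \<in> sets Y" for k
    unfolding U_def using measurable_sets[OF fn G(1)] by (intro sets.countable_UN'') auto
  have fsp: "y \<in> space Y \<Longrightarrow> f y \<in> space Y" for y using measurable_space[OF f] by blast
  have step: "f -` U k \<inter> space Y = U (Suc k)" for k
  proof (intro set_eqI iffI)
    fix y assume "y \<in> f -` U k \<inter> space Y"
    then obtain n where "n \<ge> k" "(f ^^ n) (f y) \<in> G" "y \<in> space Y" unfolding U_def by auto
    then have "Suc n \<ge> Suc k" "(f ^^ Suc n) y \<in> G" "y \<in> space Y" by (auto simp: funpow_swap1)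
    then show "y \<in> U (Suc k)" unfolding U_def by blast
  next
    fix y assume "y \<in> U (Suc k)"
    then obtain n where n: "n \<ge> Suc k" "(f ^^ n) y \<in> G" "y \<in> space Y" unfolding U_def by auto
    then obtain m where m: "n = Suc m" "m \<ge> k" by (metis Suc_le_D Suc_le_mono)
    then have "(f ^^ m) (f y) \<in> G" using n(2) by (simp add: funpow_swap1)
    with m(2) n(3) fsp show "y \<in> f -` U k \<inter> space Y" unfolding U_def by auto
  qed
  have const: "emeasure \<mu> (U k) = emeasure \<mu> (U 0)" for k
    by (induction k) (use inv[OF U_sets] step in auto)
  have dec: "decseq U" unfolding U_def decseq_def by (auto intro: order_trans)
  define L where "L = (\<Inter>k. U k)"
  have L_sets: "L \<in> sets Y" unfolding L_def using U_sets by blast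
  have "(\<lambda>k. emeasure \<mu> (U k)) \<longlonglongrightarrow> emeasure \<mu> L"
    unfolding L_def using U_sets s dec by (intro Lim_emeasure_decseq) auto
  moreover have "(\<lambda>k. emeasure \<mu> (U k)) = (\<lambda>_. emeasure \<mu> (U 0))" using const by blast
  ultimately have "emeasure \<mu> L = emeasure \<mu> (U 0)"
    by (simp add: LIMSEQ_const_iff)
  moreover have "G \<subseteq> U 0" using sets.sets_into_space[OF G(1)] unfolding U_def
    by (intro subsetI UN_I[of 0]) auto
  then have "emeasure \<mu> (U 0) \<noteq> 0"
    using G(2) emeasure_mono[of G "U 0" \<mu>] U_sets s by (metis le_zero_eq)
  moreover have "f -` L \<inter> space Y = L"
  proof -
    have "f -` L \<inter> space Y = (\<Inter>k. U (Suc k))" unfolding L_def using step by blast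
    also have "\<dots> = L"
      unfolding L_def using dec by (auto simp: decseq_Suc_iff)
    finally show ?thesis .
  qed
  ultimately have "emeasure \<mu> L = 1" using triv[OF L_sets] by auto
  then have "AE y in \<mu>. y \<in> L" using L_sets s by (simp add: AE_in_set_eq_1 measure_def)
  then show ?thesis by eventually_elim (auto simp: L_def U_def Bex_def)
qed

locale ergodic_system =
  fixes Y :: "'y measure" and T :: "'y \<Rightarrow> 'y" and \<mu> :: "'y measure"
  assumes dyn: "dynamical_system Y T" and erg: "ergodic_measure Y T \<mu>"
begin

definition Tinv :: "'y \<Rightarrow> 'y" where "Tinv = the_inv_into (space Y) T"

definition iter :: "int \<Rightarrow> 'y \<Rightarrow> 'y"
  where "iter n y = (if 0 \<le> n then (T ^^ nat n) y else (Tinv ^^ nat (- n)) y)"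

lemma prob: "prob_space \<mu>"
  and sets_mu: "sets \<mu> = sets Y"
  and T_invariant: "A \<in> sets Y \<Longrightarrow> emeasure \<mu> (T -` A \<inter> space Y) = emeasure \<mu> A"
  using erg by (auto simp: ergodic_measure_def)

lemma space_mu: "space \<mu> = space Y"
  using sets_mu by (rule sets_eq_imp_space_eq)

lemma T_measurable: "T \<in> measurable Y Y"
  and Tinv_measurable: "Tinv \<in> measurable Y Y"
  and T_bij: "bij_betw T (space Y) (space Y)"
  and standard: "standard_borel Y"
  using dyn by (auto simp: dynamical_system_def Tinv_def)

lemma T_space: "y \<in> space Y \<Longrightarrow> T y \<in> space Y"
  and Tinv_space: "y \<in> space Y \<Longrightarrow> Tinv y \<in> space Y"
  using measurable_space[OF T_measurable] measurable_space[OF Tinv_measurable] by blast+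

lemma Tinv_T: "y \<in> space Y \<Longrightarrow> Tinv (T y) = y"
  and T_Tinv: "y \<in> space Y \<Longrightarrow> T (Tinv y) = y"
  using T_bij unfolding Tinv_def
  by (auto simp: bij_betw_def the_inv_into_f_f f_the_inv_into_f)

lemma Tinv_ergodic: "ergodic_measure Y Tinv \<mu>"
proof -
  have inv: "T -` (Tinv -` A \<inter> space Y) \<inter> space Y = A" if "A \<in> sets Y" for A
    using sets.sets_into_space[OF that] by (auto simp: Tinv_T T_space)
  have "emeasure \<mu> (Tinv -` A \<inter> space Y) = emeasure \<mu> A" if "A \<in> sets Y" for A
    using T_invariant[OF measurable_sets[OF Tinv_measurable that]] inv[OF that] by simp
  moreover have "emeasure \<mu> A = 0 \<or> emeasure \<mu> A = 1"
    if "A \<in> sets Y" "Tinv -` A \<inter> space Y = A" for A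
    using erg that inv[OF that(1)] by (auto simp: ergodic_measure_def)
  ultimately show ?thesis using prob sets_mu by (simp add: ergodic_measure_def)
qed

lemma iter_0 [simp]: "iter 0 y = y"
  by (simp add: iter_def)

lemma iter_space: "y \<in> space Y \<Longrightarrow> iter n y \<in> space Y"
proof -
  assume y: "y \<in> space Y"
  have "(T ^^ k) y \<in> space Y" "(Tinv ^^ k) y \<in> space Y" for k
    using y by (induction k) (auto simp: T_space Tinv_space)
  then show ?thesis by (simp add: iter_def)
qed

lemma iter_plus_1: "y \<in> space Y \<Longrightarrow> iter (n + 1) y = T (iter n y)"
proof (cases "0 \<le> n")
  case True
  then show ?thesis by (simp add: iter_def nat_add_distrib)
next
  case False
  assume y: "y \<in> space Y"
  define k where "k = nat (- n - 1)"
  have k: "nat (- n) = Suc k" "n = - int (Suc k)" using False by (auto simp: k_def)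
  have "iter (n + 1) y = (Tinv ^^ k) y" unfolding k(2) by (simp add: iter_def)
  moreover have "(Tinv ^^ k) y = iter (n + 1) y" using calculation by simp
  moreover have "iter n y = Tinv (iter (n + 1) y)"
    using False k(1) calculation(1) by (simp add: iter_def)
  ultimately show ?thesis using T_Tinv iter_space[OF y, of "n + 1"] by simp
qed

lemma iter_minus_1: "y \<in> space Y \<Longrightarrow> iter (n - 1) y = Tinv (iter n y)"
  using iter_plus_1[of y "n - 1"] Tinv_T[OF iter_space, of y "n - 1"] by simp

lemma iter_iter:
  assumes "y \<in> space Y"
  shows "iter m (iter n y) = iter (m + n) y"
proof (induction m rule: int_induct[where k = 0])
  case (step1 i)
  then show ?case
    using iter_plus_1[OF iter_space[OF assms], of i n] iter_plus_1[OF assms, of "i + n"]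
    by (simp add: algebra_simps)
next
  case (step2 i)
  then show ?case
    using iter_minus_1[OF iter_space[OF assms], of i n] iter_minus_1[OF assms, of "i + n"]
    by (simp add: algebra_simps)
qed simp

lemma iter_T: "y \<in> space Y \<Longrightarrow> iter n (T y) = iter (n + 1) y"
  using iter_iter[of y n 1] iter_plus_1[of y 0] by simp

lemma iter_measurable: "iter n \<in> measurable Y Y"
proof -
  have "T ^^ k \<in> measurable Y Y" "Tinv ^^ k \<in> measurable Y Y" for k
    by (induction k) (simp_all add: measurable_compose[OF _ T_measurable] measurable_compose[OF _ Tinv_measurable] comp_def)
  then show ?thesis unfolding iter_def by (cases "0 \<le> n") auto
qed

lemma vimage_null_sets:
  assumes "N \<in> null_sets \<mu>"
  shows "T -` N \<inter> space Y \<in> null_sets \<mu>" "Tinv -` N \<inter> space Y \<in> null_sets \<mu>"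
proof -
  have N: "N \<in> sets Y" "emeasure \<mu> N = 0" using assms sets_mu by auto
  have "emeasure \<mu> (Tinv -` N \<inter> space Y) = emeasure \<mu> N"
    using Tinv_ergodic N(1) by (simp add: ergodic_measure_def)
  then show "Tinv -` N \<inter> space Y \<in> null_sets \<mu>"
    using N measurable_sets[OF Tinv_measurable N(1)] sets_mu by (simp add: null_setsI)
  show "T -` N \<inter> space Y \<in> null_sets \<mu>"
    using N T_invariant[OF N(1)] measurable_sets[OF T_measurable N(1)] sets_mu by (simp add: null_setsI)
qed

lemma iter_null_sets:
  assumes "N \<in> null_sets \<mu>"
  shows "iter n -` N \<inter> space Y \<in> null_sets \<mu>"
proof (induction n rule: int_induct[where k = 0])
  case base
  have "(\<lambda>y. y) -` N \<inter> space Y = N" using assms sets.sets_into_space space_mu by fastforce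
  then show ?case using assms by (simp add: iter_def[abs_def])
next
  case (step1 i)
  have "iter (i + 1) -` N \<inter> space Y = T -` (iter i -` N \<inter> space Y) \<inter> space Y"
    by (auto simp: iter_T T_space)
  then show ?case using vimage_null_sets(1)[OF step1(2)] by simp
next
  case (step2 i)
  have "iter i (Tinv y) = iter (i - 1) y" if "y \<in> space Y" for y
    using iter_T[OF Tinv_space[OF that], of "i - 1"] T_Tinv[OF that] by simp
  then have "iter (i - 1) -` N \<inter> space Y = Tinv -` (iter i -` N \<inter> space Y) \<inter> space Y"
    by (auto simp: Tinv_space)
  then show ?case using vimage_null_sets(2)[OF step2(2)] by simp
qed

lemma iter_recurrence:
  assumes "G \<in> sets Y" "emeasure \<mu> G \<noteq> 0"
  shows "AE y in \<mu>. (\<forall>k. \<exists>n\<ge>k. iter n y \<in> G) \<and> (\<forall>k. \<exists>n\<le>k. iter n y \<in> G)"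
  using ergodic_recurrence[OF erg T_measurable assms]
    ergodic_recurrence[OF Tinv_ergodic Tinv_measurable assms]
proof eventually_elim
  case (elim y)
  show ?case
  proof (intro conjI allI)
    fix k
    obtain n where n: "n \<ge> nat k" "(T ^^ n) y \<in> G" using elim(1) by blast
    then show "\<exists>n\<ge>k. iter n y \<in> G" by (intro exI[of _ "int n"]) (auto simp: iter_def)
    obtain n where n: "n \<ge> nat (- k)" "(Tinv ^^ n) y \<in> G" using elim(2) by blast
    then have "- int n \<le> k" "iter (- int n) y \<in> G" by (auto simp: iter_def)
    then show "\<exists>n\<le>k. iter n y \<in> G" by blast
  qed
qed

end

section \<open>Excellent codings\<close>

lemma infinite_constant_value:
  assumes "infinite A" "\<And>n. n \<in> A \<Longrightarrow> f n \<in> S" "finite S"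
  shows "\<exists>v\<in>S. infinite {n \<in> A. f n = v}"
proof -
  have "finite (f ` A)" using assms(2,3) by (meson finite_subset image_subsetI)
  then obtain a where "a \<in> A" "infinite {n \<in> A. f n = f a}"
    using pigeonhole_infinite[OF assms(1)] by blast
  with assms(2) show ?thesis by blast
qed

lemma regular_part_transfer:
  assumes x: "x \<in> regular_part V X" and z: "z \<in> X'" and zV: "\<And>n. z n \<in> V'"
    and fin: "\<And>u. u \<in> V \<Longrightarrow> finite (\<Phi> u)" and \<Phi>: "\<And>n. z n \<in> \<Phi> (x n)"
  shows "z \<in> regular_part V' X'"
proof -
  obtain u v where uv: "u \<in> V" "v \<in> V" "infinite {n::nat. x (- int n) = u}"
      "infinite {n::nat. x (int n) = v}"
    using x unfolding regular_part_def by blast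
  have ex: "\<exists>b\<in>V'. infinite {n::nat. z (f n) = b}"
    if a: "a \<in> V" "infinite {n::nat. x (f n) = a}" for f a
  proof -
    obtain b where b: "infinite {n \<in> {n. x (f n) = a}. z (f n) = b}"
      using infinite_constant_value[OF a(2), of "\<lambda>n. z (f n)" "\<Phi> a"] \<Phi> fin[OF a(1)] by blast
    then have inf: "infinite {n. z (f n) = b}"
      by (rule contrapos_nn) (auto elim: finite_subset[rotated])
    moreover have "b \<in> V'" using not_finite_existsD[OF inf] zV by blast
    ultimately show ?thesis by blast
  qed
  show ?thesis
    using ex[OF uv(1,3)] ex[OF uv(2,4)] z unfolding regular_part_def by blast
qed

lemma shift_markov: "x \<in> markov_shift E \<Longrightarrow> (\<lambda>n. x (n + k)) \<in> markov_shift E"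
  by (auto simp: markov_shift_def) (metis add.assoc add.commute)

lemma translate_regular:
  assumes "x \<in> markov_regular V E"
  shows "(\<lambda>n. x (n + k)) \<in> markov_regular V E"
proof -
  obtain u v where uv: "u \<in> V" "v \<in> V" "infinite {n::nat. x (- int n) = u}"
      "infinite {n::nat. x (int n) = v}"
    using assms unfolding regular_part_def by blast
  have "\<exists>n\<ge>m. x (- int n + k) = u" for m
  proof -
    obtain n where "n \<ge> nat (int m + \<bar>k\<bar>)" "x (- int n) = u"
      using uv(3) unfolding infinite_nat_iff_unbounded_le by blast
    then show ?thesis by (intro exI[of _ "nat (int n + k)"]) auto
  qed
  moreover have "\<exists>n\<ge>m. x (int n + k) = v" for m
  proof -
    obtain n where "n \<ge> nat (int m + \<bar>k\<bar>)" "x (int n) = v"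
      using uv(4) unfolding infinite_nat_iff_unbounded_le by blast
    then show ?thesis by (intro exI[of _ "nat (int n - k)"]) auto
  qed
  moreover have "(\<lambda>n. x (n + k)) \<in> markov_shift E"
    using assms shift_markov by (auto simp: regular_part_def)
  ultimately show ?thesis
    using uv(1,2) unfolding regular_part_def infinite_nat_iff_unbounded_le by blast
qed

lemma shift_regular: "x \<in> markov_regular V E \<Longrightarrow> shift_map x \<in> markov_regular V E"
  unfolding shift_map_def by (rule translate_regular)

lemma markov_shift_closed:
  assumes "\<And>m. \<exists>y\<in>markov_shift E. agree m x y"
  shows "x \<in> markov_shift E"
proof -
  have "(x n, x (n + 1)) \<in> E" for n
  proof -
    obtain y where "y \<in> markov_shift E" "agree (nat (\<bar>n\<bar> + 1)) x y" using assms by blast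
    then show ?thesis unfolding markov_shift_def agree_def by force
  qed
  then show ?thesis by (simp add: markov_shift_def)
qed

lemma biinfinite_path_through:
  fixes A :: "int \<Rightarrow> 'a set"
  assumes fwd: "\<And>n d. d \<in> A n \<Longrightarrow> \<exists>d'\<in>A (n + 1). (d, d') \<in> E"
    and bwd: "\<And>n d'. d' \<in> A (n + 1) \<Longrightarrow> \<exists>d\<in>A n. (d, d') \<in> E"
    and d: "d \<in> A m"
  shows "\<exists>x\<in>markov_shift E. (\<forall>n. x n \<in> A n) \<and> x m = d"
proof -
  have "\<exists>f. \<forall>k. (f k \<in> A (m + int k) \<and> (k = 0 \<longrightarrow> f k = d)) \<and> (f k, f (Suc k)) \<in> E"
  proof (rule dependent_nat_choice)
    fix x k assume "x \<in> A (m + int k) \<and> (k = 0 \<longrightarrow> x = d)"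
    then show "\<exists>y. (y \<in> A (m + int (Suc k)) \<and> (Suc k = 0 \<longrightarrow> y = d)) \<and> (x, y) \<in> E"
      using fwd[of x "m + int k"] by (auto simp: algebra_simps)
  qed (use d in auto)
  then obtain f where f: "\<And>k. f k \<in> A (m + int k)" "f 0 = d" "\<And>k. (f k, f (Suc k)) \<in> E" by blast
  have "\<exists>g. \<forall>k. (g k \<in> A (m - int k) \<and> (k = 0 \<longrightarrow> g k = d)) \<and> (g (Suc k), g k) \<in> E"
  proof (rule dependent_nat_choice)
    fix x k assume "x \<in> A (m - int k) \<and> (k = 0 \<longrightarrow> x = d)"
    then show "\<exists>y. (y \<in> A (m - int (Suc k)) \<and> (Suc k = 0 \<longrightarrow> y = d)) \<and> (y, x) \<in> E"
      using bwd[of x "m - int (Suc k)"] by (auto simp: algebra_simps)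
  qed (use d in auto)
  then obtain g where g: "\<And>k. g k \<in> A (m - int k)" "g 0 = d" "\<And>k. (g (Suc k), g k) \<in> E" by blast
  define x where "x = (\<lambda>n. if m \<le> n then f (nat (n - m)) else g (nat (m - n)))"
  have "(x n, x (n + 1)) \<in> E" for n
  proof (cases "m \<le> n")
    case True
    then have "nat (n + 1 - m) = Suc (nat (n - m))" by linarith
    then show ?thesis using True f(3) by (simp add: x_def)
  next
    case False
    then have "nat (m - n) = Suc (nat (m - (n + 1)))" by linarith
    moreover have "x (n + 1) = g (nat (m - (n + 1)))"
      using False f(2) g(2) by (auto simp: x_def)
    ultimately show ?thesis using False g(3) by (simp add: x_def)
  qed
  moreover have "x n \<in> A n" for n
    using f(1)[of "nat (n - m)"] g(1)[of "nat (m - n)"] by (auto simp: x_def)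
  moreover have "x m = d" using f(2) by (simp add: x_def)
  ultimately show ?thesis by (auto simp: markov_shift_def)
qed

lemma continuous_map_imp_measurable_borel_of:
  assumes "continuous_map S T f"
  shows "f \<in> measurable (borel_of S) (borel_of T)"
  unfolding borel_of_def[of T]
proof (rule measurable_measure_of)
  show "{U. openin T U} \<subseteq> Pow (topspace T)" by (auto dest: openin_subset)
  show "f \<in> space (borel_of S) \<rightarrow> topspace T"
    using continuous_map_image_subset_topspace[OF assms] by auto
  fix U assume "U \<in> {U. openin T U}"
  then have "openin S {x \<in> topspace S. f x \<in> U}" using assms by (simp add: continuous_map_def)
  moreover have "f -` U \<inter> space (borel_of S) = {x \<in> topspace S. f x \<in> U}" by auto
  ultimately show "f -` U \<inter> space (borel_of S) \<in> sets (borel_of S)"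
    by (simp add: openin_imp_sets_borel_of)
qed

locale excellent_coding =
  fixes V :: "'a set" and E :: "'a rel" and Y :: "'y measure" and T :: "'y \<Rightarrow> 'y"
    and p :: "(int \<Rightarrow> 'a) \<Rightarrow> 'y" and R :: "'a rel"
  assumes graph: "countable_graph V E"
    and semi: "semiconjugacy (markov_regular V E) Y T p"
    and measurable_p: "p \<in> measurable (borel_of (symb_topology (markov_regular V E))) Y"
    and finite_fibers: "\<And>y. y \<in> space Y \<Longrightarrow> finite {z \<in> markov_regular V E. p z = y}"
    and R_subset: "R \<subseteq> V \<times> V" and R_refl: "refl_on V R" and R_sym: "sym R"
    and R_locally_finite: "locally_finite_on V R"
    and bowen: "\<And>x y. x \<in> markov_regular V E \<Longrightarrow> y \<in> markov_regular V E \<Longrightarrow>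
      p x = p y \<longleftrightarrow> (\<forall>n. (x n, y n) \<in> R)"
begin

abbreviation Z :: "(int \<Rightarrow> 'a) set" where "Z \<equiv> markov_regular V E"

definition fib :: "'y \<Rightarrow> (int \<Rightarrow> 'a) set" where "fib y = {x \<in> Z. p x = y}"

lemma countable_V: "countable V" and E_subset: "E \<subseteq> V \<times> V"
  using graph by (auto simp: countable_graph_def)

lemma regular_imp_markov: "x \<in> Z \<Longrightarrow> x \<in> markov_shift E"
  by (simp add: regular_part_def)

lemma markov_V: "x \<in> markov_shift E \<Longrightarrow> x n \<in> V"
  using E_subset by (rule markov_shift_range)

lemma finite_R: "u \<in> V \<Longrightarrow> finite {b. (u, b) \<in> R}"
proof -
  assume "u \<in> V"
  then have "finite {b \<in> V. (b, u) \<in> R}"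
    using R_locally_finite by (simp add: locally_finite_on_def)
  moreover have "{b. (u, b) \<in> R} \<subseteq> {b \<in> V. (b, u) \<in> R}"
    using R_sym R_subset by (auto dest: symD)
  ultimately show ?thesis by (rule finite_subset[rotated])
qed

lemma p_space: "x \<in> Z \<Longrightarrow> p x \<in> space Y"
  and p_shift: "x \<in> Z \<Longrightarrow> p (shift_map x) = T (p x)"
  using semi by (auto simp: semiconjugacy_def)

lemma related_regular:
  assumes "x \<in> Z" "z \<in> markov_shift E" "\<And>n. (x n, z n) \<in> R"
  shows "z \<in> Z" "p z = p x"
proof -
  show "z \<in> Z"
    by (rule regular_part_transfer[OF assms(1,2), where \<Phi> = "\<lambda>u. {b. (u, b) \<in> R}"])
      (use assms finite_R markov_V in auto)
  with bowen[OF assms(1) this] assms(3) show "p z = p x" by metis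
qed

lemma finite_fib: "finite (fib y)"
proof (cases "y \<in> space Y")
  case True
  then show ?thesis using finite_fibers by (simp add: fib_def)
next
  case False
  then have "fib y = {}" using p_space by (auto simp: fib_def)
  then show ?thesis by simp
qed

lemma fib_related: "x \<in> fib y \<Longrightarrow> x' \<in> fib y \<Longrightarrow> (x n, x' n) \<in> R"
  using bowen[of x x'] by (auto simp: fib_def)

lemma splice_in_fib:
  assumes "x \<in> fib y" "x' \<in> fib y" "(x m, x' (m + 1)) \<in> E"
  shows "(\<lambda>n. if n \<le> m then x n else x' n) \<in> fib y"
proof -
  let ?z = "\<lambda>n. if n \<le> m then x n else x' n"
  have mk: "x \<in> markov_shift E" "x' \<in> markov_shift E"
    using assms regular_imp_markov by (auto simp: fib_def)
  have "(?z n, ?z (n + 1)) \<in> E" for n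
  proof (cases "n = m")
    case True
    then show ?thesis using mk assms(3) by (simp add: markov_shift_def)
  next
    case False
    then show ?thesis using mk by (auto simp: markov_shift_def)
  qed
  then have "?z \<in> markov_shift E" by (simp add: markov_shift_def)
  moreover have "(x n, ?z n) \<in> R" for n
    using fib_related[OF assms(1,1)] fib_related[OF assms(1,2)] by simp
  ultimately show ?thesis
    using related_regular[of x ?z] assms(1) by (auto simp: fib_def)
qed

lemma Z_in_sets: "Z \<in> sets cylinder_algebra"
proof -
  have "countable E" using countable_V E_subset by (meson countable_SIGMA countable_subset)
  then show ?thesis by (intro regular_part_in_sets countable_V markov_shift_in_sets)
qed

lemma Z_range: "Z \<subseteq> {x. range x \<subseteq> V}"
  using regular_imp_markov markov_V by blast

end

section \<open>Shifts of strands\<close>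

locale strand_graph = excellent_coding V E Y T p R
  for V :: "'a set" and E :: "'a rel" and Y :: "'y measure" and T :: "'y \<Rightarrow> 'y"
    and p :: "(int \<Rightarrow> 'a) \<Rightarrow> 'y" and R :: "'a rel" +
  fixes V' :: "'b set" and E' :: "'b rel" and \<delta> :: "'b \<Rightarrow> 'a set"
  assumes graph': "countable_graph V' E'" and inj_\<delta>: "inj_on \<delta> V'"
    and \<delta>_V: "\<And>i. i \<in> V' \<Longrightarrow> \<delta> i \<subseteq> V" and \<delta>_finite: "\<And>i. i \<in> V' \<Longrightarrow> finite (\<delta> i)"
    and \<delta>_nonempty: "\<And>i. i \<in> V' \<Longrightarrow> \<delta> i \<noteq> {}"
    and \<delta>_related: "\<And>i d d'. i \<in> V' \<Longrightarrow> d \<in> \<delta> i \<Longrightarrow> d' \<in> \<delta> i \<Longrightarrow> (d, d') \<in> R"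
    and fwd: "\<And>i j d. (i, j) \<in> E' \<Longrightarrow> d \<in> \<delta> i \<Longrightarrow> \<exists>!d'. d' \<in> \<delta> j \<and> (d, d') \<in> E"
    and bwd: "\<And>i j d'. (i, j) \<in> E' \<Longrightarrow> d' \<in> \<delta> j \<Longrightarrow> \<exists>!d. d \<in> \<delta> i \<and> (d, d') \<in> E"
begin

abbreviation Z' :: "(int \<Rightarrow> 'b) set" where "Z' \<equiv> markov_regular V' E'"

definition strands :: "(int \<Rightarrow> 'b) \<Rightarrow> (int \<Rightarrow> 'a) set"
  where "strands z = {x \<in> markov_shift E. \<forall>n. x n \<in> \<delta> (z n)}"

definition q :: "(int \<Rightarrow> 'b) \<Rightarrow> (int \<Rightarrow> 'a)"
  where "q z = (THE x. x \<in> strands z \<and> x 0 = (SOME d. d \<in> \<delta> (z 0)))"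

definition p' :: "(int \<Rightarrow> 'b) \<Rightarrow> 'y" where "p' z = p (q z)"

definition R' :: "'b rel"
  where "R' = {(i, j). i \<in> V' \<and> j \<in> V' \<and> (\<forall>d\<in>\<delta> i. \<forall>d'\<in>\<delta> j. (d, d') \<in> R)}"

lemma E'_subset: "E' \<subseteq> V' \<times> V'" using graph' by (simp add: countable_graph_def)

lemma markov_V': "z \<in> markov_shift E' \<Longrightarrow> z n \<in> V'"
  using E'_subset by (rule markov_shift_range)

lemma regular_imp_markov': "z \<in> Z' \<Longrightarrow> z \<in> markov_shift E'"
  by (simp add: regular_part_def)

lemma strandD: "x \<in> strands z \<Longrightarrow> x n \<in> \<delta> (z n)" "x \<in> strands z \<Longrightarrow> (x n, x (n + 1)) \<in> E"
  by (auto simp: strands_def markov_shift_def)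

lemma strand_exists:
  assumes "z \<in> markov_shift E'" "d \<in> \<delta> (z m)"
  shows "\<exists>x\<in>strands z. x m = d"
proof -
  have z: "(z n, z (n + 1)) \<in> E'" for n using assms(1) by (simp add: markov_shift_def)
  have "\<exists>x\<in>markov_shift E. (\<forall>n. x n \<in> \<delta> (z n)) \<and> x m = d"
    by (rule biinfinite_path_through) (use fwd[OF z] bwd[OF z] assms(2) in blast)+
  then show ?thesis unfolding strands_def by blast
qed

lemma strand_step:
  assumes "(i, j) \<in> E'" "d \<in> \<delta> i" "d' \<in> \<delta> j" "e \<in> \<delta> i" "e' \<in> \<delta> j" "(d, d') \<in> E" "(e, e') \<in> E"
  shows "d = e \<longleftrightarrow> d' = e'"
  using fwd[OF assms(1,2)] bwd[OF assms(1,3)] assms by blast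

lemma strand_unique:
  assumes z: "z \<in> markov_shift E'" and x: "x \<in> strands z" "x' \<in> strands z" and m: "x m = x' m"
  shows "x = x'"
proof
  have step: "x n = x' n \<longleftrightarrow> x (n + 1) = x' (n + 1)" for n
    using z strandD[OF x(1), of n] strandD[OF x(2), of n] strandD(1)[OF x(1), of "n + 1"]
      strandD(1)[OF x(2), of "n + 1"]
    by (intro strand_step[of "z n" "z (n + 1)"]) (auto simp: markov_shift_def)
  fix n
  show "x n = x' n"
    by (induction n rule: int_induct[where k = m])
      (use m step in \<open>auto simp: step[of "_ - 1", simplified]\<close>)
qed

lemma strand_agree:
  assumes z: "z \<in> markov_shift E'" "z' \<in> markov_shift E'" and x: "x \<in> strands z" "x' \<in> strands z'"
    and x0: "x 0 = x' 0" and a: "agree k z z'"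
  shows "agree k x x'"
proof -
  have step: "x n = x' n \<longleftrightarrow> x (n + 1) = x' (n + 1)" if "\<bar>n\<bar> \<le> int k" "\<bar>n + 1\<bar> \<le> int k" for n
  proof -
    have "z n = z' n" "z (n + 1) = z' (n + 1)" using a that by (auto simp: agree_def)
    moreover have "(z n, z (n + 1)) \<in> E'" using z(1) by (simp add: markov_shift_def)
    ultimately show ?thesis
      using strandD[OF x(1), of n] strandD[OF x(2), of n] strandD(1)[OF x(1), of "n + 1"]
        strandD(1)[OF x(2), of "n + 1"]
      by (intro strand_step[of "z n" "z (n + 1)"]) simp_all
  qed
  have "int j \<le> int k \<longrightarrow> x (int j) = x' (int j) \<and> x (- int j) = x' (- int j)" for j
  proof (induction j)
    case (Suc j)
    show ?case
      using Suc step[of "int j"] step[of "- int (Suc j)"] by (auto simp: algebra_simps)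
  qed (use x0 in simp)
  then have "x n = x' n" if "\<bar>n\<bar> \<le> int k" for n
    using that by (cases n rule: int_cases2) auto
  then show ?thesis by (simp add: agree_def)
qed

lemma q_strand:
  assumes "z \<in> markov_shift E'"
  shows "q z \<in> strands z" "q z 0 = (SOME d. d \<in> \<delta> (z 0))"
proof -
  have "(SOME d. d \<in> \<delta> (z 0)) \<in> \<delta> (z 0)"
    using \<delta>_nonempty[OF markov_V'[OF assms]] by (simp add: some_in_eq)
  then obtain x where x: "x \<in> strands z \<and> x 0 = (SOME d. d \<in> \<delta> (z 0))"
    using strand_exists[OF assms] by blast
  have "\<exists>!x. x \<in> strands z \<and> x 0 = (SOME d. d \<in> \<delta> (z 0))"
  proof (rule ex1I[of _ x])
    show "x \<in> strands z \<and> x 0 = (SOME d. d \<in> \<delta> (z 0))" by (rule x)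
    fix x' assume "x' \<in> strands z \<and> x' 0 = (SOME d. d \<in> \<delta> (z 0))"
    with x show "x' = x" by (intro strand_unique[OF assms, where m = 0]) simp_all
  qed
  then have "q z \<in> strands z \<and> q z 0 = (SOME d. d \<in> \<delta> (z 0))"
    unfolding q_def by (rule theI')
  then show "q z \<in> strands z" "q z 0 = (SOME d. d \<in> \<delta> (z 0))" by auto
qed

lemma q_agree:
  assumes "z \<in> markov_shift E'" "z' \<in> markov_shift E'" "agree k z z'"
  shows "agree k (q z) (q z')"
proof (rule strand_agree[OF assms(1,2) q_strand(1)[OF assms(1)] q_strand(1)[OF assms(2)] _ assms(3)])
  have "z 0 = z' 0" using assms(3) by (simp add: agree_def)
  then show "q z 0 = q z' 0" using q_strand(2) assms(1,2) by simp
qed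

lemma q_lipschitz: "one_lipschitz_on (markov_shift E') q"
  unfolding one_lipschitz_on_def
proof (intro ballI)
  fix x y assume xy: "x \<in> markov_shift E'" "y \<in> markov_shift E'"
  show "symb_dist (q x) (q y) \<le> symb_dist x y"
  proof (cases "q x = q y")
    case True
    then show ?thesis using symb_dist_nonneg[of x y] by (simp add: symb_dist_def)
  next
    case False
    then obtain n where n: "symb_dist (q x) (q y) = exp (- real_of_int \<bar>n\<bar>)" "q x n \<noteq> q y n"
      using symb_dist_attained by metis
    then have "\<not> agree (nat \<bar>n\<bar>) (q x) (q y)" by (auto simp: agree_def)
    then have "\<not> agree (nat \<bar>n\<bar>) x y" using q_agree[OF xy] by blast
    then show ?thesis using n(1) symb_dist_less_iff_agree[of x y "nat \<bar>n\<bar>"] by simp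
  qed
qed

lemma q_markov: "z \<in> markov_shift E' \<Longrightarrow> q z \<in> markov_shift E"
  using q_strand(1) by (simp add: strands_def)

lemma strand_regular:
  assumes "z \<in> Z'" "x \<in> strands z"
  shows "x \<in> Z"
  by (rule regular_part_transfer[OF assms(1), where \<Phi> = \<delta>])
    (use assms \<delta>_finite markov_V in \<open>auto simp: strands_def\<close>)

lemma q_regular: "z \<in> Z' \<Longrightarrow> q z \<in> Z"
  using strand_regular q_strand(1) regular_imp_markov' by blast

lemma finite_\<delta>_related:
  assumes "u \<in> V"
  shows "finite {i \<in> V'. \<forall>d\<in>\<delta> i. (u, d) \<in> R}"
proof (rule inj_on_finite)
  show "inj_on \<delta> {i \<in> V'. \<forall>d\<in>\<delta> i. (u, d) \<in> R}" using inj_\<delta> by (rule inj_on_subset) auto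
  show "\<delta> ` {i \<in> V'. \<forall>d\<in>\<delta> i. (u, d) \<in> R} \<subseteq> Pow {b. (u, b) \<in> R}" by auto
  show "finite (Pow {b. (u, b) \<in> R})" using finite_R[OF assms] by simp
qed

lemma strand_\<delta>_related:
  assumes "z \<in> markov_shift E'" "x \<in> strands z"
  shows "z n \<in> {i \<in> V'. \<forall>d\<in>\<delta> i. (x n, d) \<in> R}"
  using markov_V'[OF assms(1)] \<delta>_related[OF markov_V'[OF assms(1)] strandD(1)[OF assms(2)]]
  by simp

lemma regular_if_strand_regular:
  assumes "z \<in> markov_shift E'" "x \<in> strands z" "x \<in> Z"
  shows "z \<in> Z'"
  by (rule regular_part_transfer[OF assms(3,1) _ finite_\<delta>_related])
    (use strand_\<delta>_related[OF assms(1,2)] in auto)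

lemma strands_same_image:
  assumes "z \<in> Z'" "x \<in> strands z"
  shows "p x = p' z"
  unfolding p'_def
proof (rule related_regular(2)[OF q_regular[OF assms(1)]])
  have z: "z \<in> markov_shift E'" using assms(1) by (rule regular_imp_markov')
  show "x \<in> markov_shift E" using assms(2) by (simp add: strands_def)
  show "(q z n, x n) \<in> R" for n
    using strand_\<delta>_related[OF z q_strand(1)[OF z], of n] strandD(1)[OF assms(2), of n] by blast
qed

lemma strands_subset_fib: "z \<in> Z' \<Longrightarrow> strands z \<subseteq> fib (p' z)"
  using strand_regular strands_same_image by (auto simp: fib_def)

lemma \<delta>_eq_strands: "z \<in> markov_shift E' \<Longrightarrow> \<delta> (z n) = (\<lambda>x. x n) ` strands z"
proof (intro equalityI subsetI)
  fix d assume "z \<in> markov_shift E'" "d \<in> \<delta> (z n)"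
  then obtain x where "x \<in> strands z" "x n = d" using strand_exists by blast
  then show "d \<in> (\<lambda>x. x n) ` strands z" by blast
qed (auto simp: strandD(1))

lemma shift_strand: "x \<in> strands z \<Longrightarrow> shift_map x \<in> strands (shift_map z)"
  using shift_markov[of x E 1] by (simp add: strands_def shift_map_def)

lemma p'_shift:
  assumes "z \<in> Z'"
  shows "p' (shift_map z) = T (p' z)"
proof -
  have "shift_map (q z) \<in> strands (shift_map z)"
    using shift_strand q_strand(1) regular_imp_markov' assms by blast
  then have "p (shift_map (q z)) = p' (shift_map z)"
    using strands_same_image shift_regular assms by blast
  then show ?thesis using p_shift[OF q_regular[OF assms]] by (simp add: p'_def)
qed

lemma p'_eq_iff:
  assumes "z \<in> Z'" "w \<in> Z'"
  shows "p' z = p' w \<longleftrightarrow> (\<forall>n. (z n, w n) \<in> R')"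
proof
  have mk: "z \<in> markov_shift E'" "w \<in> markov_shift E'" using assms regular_imp_markov' by auto
  {
    assume eq: "p' z = p' w"
    have "(d, d') \<in> R" if d: "d \<in> \<delta> (z n)" "d' \<in> \<delta> (w n)" for n d d'
    proof -
      obtain x x' where x: "x \<in> strands z" "x n = d" "x' \<in> strands w" "x' n = d'"
        using strand_exists[OF mk(1) d(1)] strand_exists[OF mk(2) d(2)] by blast
      then have "x \<in> fib (p' z)" "x' \<in> fib (p' z)" using subsetD[OF strands_subset_fib[OF assms(1)] x(1)]
          subsetD[OF strands_subset_fib[OF assms(2)] x(3)] eq by simp_all
      with x fib_related show ?thesis by blast
    qed
    then show "\<forall>n. (z n, w n) \<in> R'" using markov_V' mk by (auto simp: R'_def)
  next
    assume r: "\<forall>n. (z n, w n) \<in> R'"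
    have "(q z n, q w n) \<in> R" for n
      using r strandD(1)[OF q_strand(1)[OF mk(1)], of n] strandD(1)[OF q_strand(1)[OF mk(2)], of n]
      unfolding R'_def by blast
    then show "p' z = p' w" using bowen q_regular assms by (auto simp: p'_def)
  }
qed

lemma fiber_bound:
  shows "finite {z \<in> Z'. p' z = y}" "card {z \<in> Z'. p' z = y} \<le> 2 ^ card (fib y)"
proof -
  have inj: "inj_on strands {z \<in> Z'. p' z = y}"
  proof (rule inj_onI, rule ext)
    fix z w n assume zw: "z \<in> {z \<in> Z'. p' z = y}" "w \<in> {z \<in> Z'. p' z = y}" "strands z = strands w"
    then have mk: "z \<in> markov_shift E'" "w \<in> markov_shift E'" using regular_imp_markov' by auto
    then have "\<delta> (z n) = \<delta> (w n)" using \<delta>_eq_strands zw(3) by simp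
    then show "z n = w n" using inj_\<delta> markov_V' mk by (auto dest: inj_onD)
  qed
  have sub: "strands ` {z \<in> Z'. p' z = y} \<subseteq> Pow (fib y)" using strands_subset_fib by blast
  have fin: "finite (Pow (fib y))" using finite_fib by simp
  show "finite {z \<in> Z'. p' z = y}" using inj sub fin by (rule inj_on_finite)
  show "card {z \<in> Z'. p' z = y} \<le> 2 ^ card (fib y)"
    using card_inj_on_le[OF inj sub fin] by (simp add: card_Pow finite_fib)
qed

lemma q_continuous: "continuous_map (symb_topology Z') (symb_topology Z) q"
  by (rule continuous_map_symb_topologyI) (use q_regular q_agree regular_imp_markov' in blast)+

lemma excellent_p': "excellent_semiconjugacy V' Z' Y T p'"
  unfolding excellent_semiconjugacy_def
proof (intro conjI exI[of _ R'])
  show "semiconjugacy Z' Y T p'"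
    using p'_shift p_space q_regular by (simp add: semiconjugacy_def p'_def)
  have "p' = (\<lambda>z. p (q z))" by (simp add: p'_def fun_eq_iff)
  then show "p' \<in> measurable (borel_of (symb_topology Z')) Y"
    using measurable_compose[OF continuous_map_imp_measurable_borel_of[OF q_continuous] measurable_p]
    by simp
  show "\<forall>y\<in>space Y. finite {z \<in> Z'. p' z = y}" using fiber_bound(1) by blast
  show "R' \<subseteq> V' \<times> V'" by (auto simp: R'_def)
  show "refl_on V' R'" using \<delta>_related by (auto simp: R'_def refl_on_def)
  show "sym R'" using R_sym by (auto simp: R'_def sym_def)
  show "\<forall>x\<in>Z'. \<forall>y\<in>Z'. (p' x = p' y) = (\<forall>n. (x n, y n) \<in> R')" using p'_eq_iff by blast
  show "locally_finite_on V' R'"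
    unfolding locally_finite_on_def
  proof
    fix i assume i: "i \<in> V'"
    obtain u where u: "u \<in> \<delta> i" using \<delta>_nonempty[OF i] by blast
    have "{b \<in> V'. (b, i) \<in> R'} \<subseteq> {j \<in> V'. \<forall>d\<in>\<delta> j. (u, d) \<in> R}"
      using u R_sym by (auto simp: R'_def dest: symD)
    then show "finite {b \<in> V'. (b, i) \<in> R'}"
      using finite_\<delta>_related \<delta>_V[OF i] u by (meson finite_subset subsetD)
  qed
qed

lemma multiplicity_bound_p':
  assumes C: "multiplicity_bound V Z p C"
  shows "multiplicity_bound V' Z' p' (\<lambda>i j. 2 ^ (\<Sum>u\<in>\<delta> i. \<Sum>v\<in>\<delta> j. C u v))"
  unfolding multiplicity_bound_def
proof (intro ballI impI, elim conjE)
  fix z i j assume z: "z \<in> Z'" and ij: "i \<in> V'" "j \<in> V'"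
    and inf: "infinite {n. 0 < n \<and> z (- int n) = i}" "infinite {n. 0 < n \<and> z (int n) = j}"
  have qd: "q z n \<in> \<delta> (z n)" for n
    using strandD(1) q_strand(1) regular_imp_markov' z by blast
  have ex: "\<exists>u\<in>\<delta> a. infinite {n. 0 < n \<and> q z (f n) = u}"
    if a: "a \<in> V'" "infinite {n. 0 < n \<and> z (f n) = a}" for a and f :: "nat \<Rightarrow> int"
  proof -
    obtain u where u: "u \<in> \<delta> a" "infinite {n \<in> {n. 0 < n \<and> z (f n) = a}. q z (f n) = u}"
      using infinite_constant_value[OF a(2), of "\<lambda>n. q z (f n)" "\<delta> a"] qd \<delta>_finite[OF a(1)]
      by force
    have "{n \<in> {n. 0 < n \<and> z (f n) = a}. q z (f n) = u} \<subseteq> {n. 0 < n \<and> q z (f n) = u}" by blast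
    then show ?thesis using u infinite_super by blast
  qed
  obtain u v where uv: "u \<in> \<delta> i" "infinite {n. 0 < n \<and> q z (- int n) = u}"
    "v \<in> \<delta> j" "infinite {n. 0 < n \<and> q z (int n) = v}"
    using ex[OF ij(1) inf(1)] ex[OF ij(2) inf(2)] by blast
  have "card (fib (p' z)) \<le> C u v"
    using C q_regular[OF z] uv \<delta>_V[OF ij(1)] \<delta>_V[OF ij(2)]
    unfolding multiplicity_bound_def fib_def p'_def by blast
  also have "\<dots> \<le> (\<Sum>v\<in>\<delta> j. C u v)" using uv(3) \<delta>_finite[OF ij(2)] by (intro member_le_sum) auto
  also have "\<dots> \<le> (\<Sum>u\<in>\<delta> i. \<Sum>v\<in>\<delta> j. C u v)"
    using uv(1) \<delta>_finite[OF ij(1)] member_le_sum[of u "\<delta> i" "\<lambda>u. \<Sum>v\<in>\<delta> j. C u v"] by simp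
  finally have "(2::nat) ^ card (fib (p' z)) \<le> 2 ^ (\<Sum>u\<in>\<delta> i. \<Sum>v\<in>\<delta> j. C u v)"
    by (intro power_increasing) auto
  then show "finite {w \<in> Z'. p' w = p' z} \<and>
      card {w \<in> Z'. p' w = p' z} \<le> 2 ^ (\<Sum>u\<in>\<delta> i. \<Sum>v\<in>\<delta> j. C u v)"
    using fiber_bound[of "p' z"] by linarith
qed

lemma q_proper:
  assumes K: "compactin (symb_topology Z) K"
  shows "compactin (symb_topology Z') (q -` K \<inter> Z')"
proof (rule compactin_symb_topologyI)
  have KZ: "K \<subseteq> Z" using compactin_subset_topspace[OF K] by simp
  fix n
  have "(\<lambda>z. z n) ` (q -` K \<inter> Z') \<subseteq> (\<Union>u\<in>(\<lambda>x. x n) ` K. {i \<in> V'. \<forall>d\<in>\<delta> i. (u, d) \<in> R})"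
    using strand_\<delta>_related q_strand(1) regular_imp_markov' by blast
  moreover have "finite \<dots>"
    using compactin_imp_finite_coordinate[OF K] KZ markov_V regular_imp_markov
    by (intro finite_UN_I finite_\<delta>_related) auto
  ultimately show "finite ((\<lambda>z. z n) ` (q -` K \<inter> Z'))" by (rule finite_subset)
next
  fix z assume lim: "\<And>m. \<exists>w\<in>q -` K \<inter> Z'. agree m z w"
  have mk: "z \<in> markov_shift E'"
    by (rule markov_shift_closed) (use lim regular_imp_markov' in blast)
  have "q z \<in> K"
  proof (rule compactin_imp_closed[OF K])
    fix m
    obtain w where "w \<in> q -` K \<inter> Z'" "agree m z w" using lim by blast
    then show "\<exists>y\<in>K. agree m (q z) y" using q_agree[OF mk] regular_imp_markov' by blast
  qed
  moreover have "K \<subseteq> Z" using compactin_subset_topspace[OF K] by simp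
  ultimately show "z \<in> q -` K \<inter> Z'"
    using regular_if_strand_regular[OF mk q_strand(1)[OF mk]] by blast
qed auto

lemma locally_compact_lift:
  assumes LC: "locally_compact_space (symb_topology (markov_shift E))"
  shows "locally_compact_space (symb_topology (markov_shift E'))"
  unfolding locally_compact_space_def
proof (intro ballI)
  fix z assume "z \<in> topspace (symb_topology (markov_shift E'))"
  then have z: "z \<in> markov_shift E'" by simp
  have "\<exists>k K. compactin (symb_topology (markov_shift E)) K \<and>
      {y \<in> markov_shift E. agree k x y} \<subseteq> K" if x: "x \<in> strands z" for x
  proof -
    have "x \<in> markov_shift E" using x by (simp add: strands_def)
    then obtain U K where UK: "openin (symb_topology (markov_shift E)) U"
        "compactin (symb_topology (markov_shift E)) K" "x \<in> U" "U \<subseteq> K"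
      using LC unfolding locally_compact_space_def by auto
    then show ?thesis unfolding openin_symb_topology by blast
  qed
  then obtain k K where K: "\<And>x. x \<in> strands z \<Longrightarrow> compactin (symb_topology (markov_shift E)) (K x)"
      "\<And>x. x \<in> strands z \<Longrightarrow> {y \<in> markov_shift E. agree (k x) x y} \<subseteq> K x"
    by metis
  have "inj_on (\<lambda>x. x 0) (strands z)" using strand_unique[OF z] by (auto intro: inj_onI)
  then have fin: "finite (strands z)"
    by (rule inj_on_finite[of _ _ "\<delta> (z 0)"]) (use strandD(1) \<delta>_finite markov_V' z in auto)
  define m where "m = Max (insert 0 (k ` strands z))"
  have m: "k x \<le> m" if "x \<in> strands z" for x using fin that by (simp add: m_def)
  let ?U = "{w \<in> markov_shift E'. agree m z w}"
  have "compactin (symb_topology (markov_shift E')) ?U"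
  proof (rule compactin_symb_topologyI)
    fix n
    let ?S = "\<Union>x\<in>strands z. (\<lambda>y. y n) ` K x"
    have "\<delta> (w n) \<subseteq> ?S" if w: "w \<in> ?U" for w
    proof
      fix d assume d: "d \<in> \<delta> (w n)"
      obtain y where y: "y \<in> strands w" "y n = d" using strand_exists d w by blast
      have "z 0 = w 0" using w by (simp add: agree_def)
      then obtain x where x: "x \<in> strands z" "x 0 = y 0"
        using strand_exists[OF z, of "y 0" 0] strandD(1)[OF y(1), of 0] by auto
      have "agree m x y" using strand_agree[OF z _ x(1) y(1) x(2)] w by blast
      then have "agree (k x) x y" using m[OF x(1)] agree_mono by blast
      then have "y \<in> K x" using K(2)[OF x(1)] y(1) by (auto simp: strands_def)
      with x(1) y(2) show "d \<in> ?S" by blast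
    qed
    then have "(\<lambda>w. w n) ` ?U \<subseteq> {i \<in> V'. \<delta> i \<subseteq> ?S}" using markov_V' by blast
    moreover have "finite {i \<in> V'. \<delta> i \<subseteq> ?S}"
    proof (rule inj_on_finite)
      show "inj_on \<delta> {i \<in> V'. \<delta> i \<subseteq> ?S}" using inj_\<delta> by (rule inj_on_subset) auto
      show "\<delta> ` {i \<in> V'. \<delta> i \<subseteq> ?S} \<subseteq> Pow ?S" by auto
      show "finite (Pow ?S)" using fin K(1) compactin_imp_finite_coordinate by fastforce
    qed
    ultimately show "finite ((\<lambda>w. w n) ` ?U)" by (rule finite_subset)
  next
    fix w assume lim: "\<And>i. \<exists>y\<in>?U. agree i w y"
    have "w \<in> markov_shift E'" by (rule markov_shift_closed) (use lim in blast)
    moreover have "agree m z w" using lim[of m] agree_trans agree_sym by blast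
    ultimately show "w \<in> ?U" by blast
  qed auto
  moreover have "openin (symb_topology (markov_shift E')) ?U" by (rule openin_agree)
  ultimately show "\<exists>U K. openin (symb_topology (markov_shift E')) U \<and>
      compactin (symb_topology (markov_shift E')) K \<and> z \<in> U \<and> U \<subseteq> K"
    using z agree_refl by blast
qed

end

section \<open>Typical fibers\<close>

lemma completion_subset_positive:
  assumes "A \<in> sets (completion M)" "A \<notin> null_sets (completion M)"
  obtains G where "G \<in> sets M" "G \<subseteq> A" "emeasure M G \<noteq> 0"
proof
  show "main_part M A \<in> sets M" using assms(1) by simp
  show "main_part M A \<subseteq> A" using main_part_null_part_Un[OF assms(1)] by blast
  show "emeasure M (main_part M A) \<noteq> 0"
    using assms emeasure_completion[OF assms(1)] by (auto simp: null_sets_def)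
qed

lemma completion_common_null_set:
  fixes A :: "'i::countable \<Rightarrow> 'a set"
  assumes "\<And>i. A i \<in> sets (completion M)"
  obtains N where "N \<in> null_sets M" "\<And>i. A i - N \<in> sets M"
proof -
  have "\<exists>S N. S \<in> sets M \<and> N \<in> null_sets M \<and> S \<subseteq> A i \<and> A i \<subseteq> S \<union> N" for i
    using assms[of i] by (elim sets_completionE) blast
  then obtain S N where SN: "\<And>i. S i \<in> sets M" "\<And>i. N i \<in> null_sets M"
      "\<And>i. S i \<subseteq> A i" "\<And>i. A i \<subseteq> S i \<union> N i"
    by metis
  show thesis
  proof
    show null: "(\<Union>i. N i) \<in> null_sets M" using SN(2) by (rule null_sets_UN)
    fix i
    have "A i - (\<Union>i. N i) = S i - (\<Union>i. N i)" using SN(3,4)[of i] by blast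
    also have "\<dots> \<in> sets M" using SN(1) null by blast
    finally show "A i - (\<Union>i. N i) \<in> sets M" .
  qed
qed

lemma markov_shift_trancl:
  assumes "z \<in> markov_shift E" "m < n"
  shows "(z m, z n) \<in> E\<^sup>+"
  using assms(2)
proof (induction n rule: int_gr_induct)
  case base
  then show ?case using assms(1) by (auto simp: markov_shift_def)
next
  case (step n)
  then show ?case using assms(1) by (auto simp: markov_shift_def intro: trancl_into_trancl)
qed

locale ergodic_coding = excellent_coding V E Y T p R + ergodic_system Y T \<mu>
  for V :: "'a set" and E :: "'a rel" and Y :: "'y measure" and T :: "'y \<Rightarrow> 'y"
    and p :: "(int \<Rightarrow> 'a) \<Rightarrow> 'y" and R :: "'a rel" and \<mu> :: "'y measure" +
  assumes full: "emeasure \<mu> (p ` markov_regular V E) = 1"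
begin

sublocale prob_space \<mu> by (rule prob)

definition slice :: "'y \<Rightarrow> int \<Rightarrow> 'a set" where "slice y n = (\<lambda>x. x n) ` fib y"

definition pair_image :: "int \<Rightarrow> 'a \<Rightarrow> 'a \<Rightarrow> 'y set"
  where "pair_image L a b = p ` (Z \<inter> {x. x 0 = a \<and> x L = b})"

definition collision :: "'y set"
  where "collision = (\<Union>(L, a, b, b')\<in>{(L, a, b, b'). L \<noteq> 0 \<and> a \<in> V \<and> b \<in> V \<and> b' \<in> V \<and> b \<noteq> b'}.
    pair_image L a b \<inter> pair_image L a b')"

lemma image_in_completion_mu:
  "D \<in> sets cylinder_algebra \<Longrightarrow> p ` (Z \<inter> D) \<in> sets (completion \<mu>)"
  by (rule image_in_completion[OF standard countable_V Z_range Z_in_sets measurable_p _ finite_measure_axioms sets_mu])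

lemma p_translate:
  assumes "x \<in> Z"
  shows "p (\<lambda>k. x (k + n)) = iter n (p x)"
proof -
  have step: "p (\<lambda>k. x (k + (i + 1))) = T (p (\<lambda>k. x (k + i)))" for i
    using p_shift[OF translate_regular[OF assms, of i]] by (simp add: shift_map_def algebra_simps)
  show ?thesis
  proof (induction n rule: int_induct[where k = 0])
    case (step1 i)
    then show ?case using step[of i] iter_plus_1[OF p_space[OF assms], of i] by simp
  next
    case (step2 i)
    have "T (p (\<lambda>k. x (k + (i - 1)))) = iter i (p x)" using step[of "i - 1"] step2(2) by simp
    then show ?case
      using Tinv_T[OF p_space[OF translate_regular[OF assms, of "i - 1"]]]
        iter_minus_1[OF p_space[OF assms], of i] by simp
  qed simp
qed

lemma fib_iter:
  assumes "y \<in> space Y"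
  shows "fib (iter n y) = (\<lambda>x k. x (k + n)) ` fib y"
proof (intro equalityI subsetI)
  fix w assume w: "w \<in> fib (iter n y)"
  let ?x = "\<lambda>k. w (k + - n)"
  have "?x \<in> fib y"
    using w p_translate[of w "- n"] translate_regular[of w V E "- n"] iter_iter[OF assms, of "- n" n]
    by (simp add: fib_def)
  then show "w \<in> (\<lambda>x k. x (k + n)) ` fib y" by (rule rev_image_eqI) simp
next
  fix w assume "w \<in> (\<lambda>x k. x (k + n)) ` fib y"
  then obtain x where x: "x \<in> Z" "p x = y" "w = (\<lambda>k. x (k + n))" unfolding fib_def by blast
  then show "w \<in> fib (iter n y)" using p_translate translate_regular[of x V E n] by (simp add: fib_def)
qed

lemma slice_iter: "y \<in> space Y \<Longrightarrow> slice (iter n y) m = slice y (m + n)"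
  by (simp add: slice_def fib_iter image_image)

lemma pair_image_in_completion: "pair_image L a b \<in> sets (completion \<mu>)"
proof -
  have "{x :: int \<Rightarrow> 'a. x 0 = a \<and> x L = b} = {x. x 0 = a} \<inter> {x. x L = b}" by blast
  also have "\<dots> \<in> sets cylinder_algebra" by (intro sets.Int cylinder_in_sets)
  finally show ?thesis unfolding pair_image_def by (rule image_in_completion_mu)
qed

lemma splice_meeting:
  assumes "x \<in> fib y" "x' \<in> fib y" "x n = x' n"
  shows "(\<lambda>k. if k \<le> n then x k else x' k) \<in> fib y"
proof (rule splice_in_fib[OF assms(1,2)])
  have "x' \<in> markov_shift E" using assms(2) regular_imp_markov by (simp add: fib_def)
  then show "(x n, x' (n + 1)) \<in> E" using assms(3) by (simp add: markov_shift_def)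
qed

text \<open>Two points of a fiber that meet and later (or earlier) differ can be spliced into a pair that
  agrees on a whole half-line up to the meeting time. Recurrence of such meetings produces infinitely
  many different pairs in a finite fiber.\<close>

lemma not_recurrent_collision:
  assumes y: "y \<in> space Y" and L: "L \<noteq> 0" and b: "b \<noteq> b'"
    and rec: "\<forall>k. \<exists>n\<ge>k. iter n y \<in> pair_image L a b \<inter> pair_image L a b'"
  shows False
proof -
  define A where "A = {n::nat. iter (int n) y \<in> pair_image L a b \<inter> pair_image L a b'}"
  have "\<exists>n\<ge>m. n \<in> A" for m
  proof -
    obtain n where "n \<ge> int m" "iter n y \<in> pair_image L a b \<inter> pair_image L a b'" using rec by blast
    then show ?thesis by (intro exI[of _ "nat n"]) (auto simp: A_def)
  qed
  then have A: "infinite A" by (simp add: infinite_nat_iff_unbounded_le)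
  define half where "half = (\<lambda>n k. if 0 < L then k \<le> n else n \<le> (k::int))"
  have "\<exists>xz. xz \<in> fib y \<times> fib y \<and> (\<forall>k. half (int n) k \<longrightarrow> fst xz k = snd xz k) \<and>
      fst xz (int n + L) \<noteq> snd xz (int n + L)" if n: "n \<in> A" for n
  proof -
    obtain w w' where w: "w \<in> Z" "p w = iter (int n) y" "w 0 = a" "w L = b"
      "w' \<in> Z" "p w' = iter (int n) y" "w' 0 = a" "w' L = b'"
      using n unfolding A_def pair_image_def by force
    then have "w \<in> fib (iter (int n) y)" "w' \<in> fib (iter (int n) y)" by (auto simp: fib_def)
    then obtain x x' where x: "x \<in> fib y" "w = (\<lambda>k. x (k + int n))"
      "x' \<in> fib y" "w' = (\<lambda>k. x' (k + int n))"
      unfolding fib_iter[OF y] by blast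
    have meet: "x (int n) = x' (int n)" "x (int n + L) \<noteq> x' (int n + L)"
      using w(3,4,7,8) b unfolding x(2,4) by (auto simp: add.commute)
    show ?thesis
    proof (cases "0 < L")
      case True
      let ?z = "\<lambda>k. if k \<le> int n then x k else x' k"
      have "?z \<in> fib y" by (rule splice_meeting[OF x(1,3) meet(1)])
      then show ?thesis using x(1) meet True by (intro exI[of _ "(x, ?z)"]) (auto simp: half_def)
    next
      case False
      let ?z = "\<lambda>k. if k \<le> int n then x' k else x k"
      have "?z \<in> fib y" by (rule splice_meeting[OF x(3,1) meet(1)[symmetric]])
      then show ?thesis
        using x(1) meet False L by (intro exI[of _ "(x, ?z)"]) (auto simp: half_def)
    qed
  qed
  then obtain f where f: "\<And>n. n \<in> A \<Longrightarrow> f n \<in> fib y \<times> fib y"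
    "\<And>n k. n \<in> A \<Longrightarrow> half (int n) k \<Longrightarrow> fst (f n) k = snd (f n) k"
    "\<And>n. n \<in> A \<Longrightarrow> fst (f n) (int n + L) \<noteq> snd (f n) (int n + L)"
    by metis
  obtain c where c: "infinite {n \<in> A. f n = c}"
    using infinite_constant_value[OF A, of f "fib y \<times> fib y"] f(1) finite_fib by blast
  obtain m where m: "m \<in> A" "f m = c" using not_finite_existsD[OF c] by blast
  obtain n where n: "n \<ge> m + nat \<bar>L\<bar>" "n \<in> A" "f n = c"
    using c unfolding infinite_nat_iff_unbounded_le by blast
  show False
  proof (cases "0 < L")
    case True
    then have "half (int n) (int m + L)" using n(1) by (auto simp: half_def)
    then show False using f(2)[OF n(2)] f(3)[OF m(1)] m n by simp
  next
    case False
    then have "half (int m) (int n + L)" using n(1) by (auto simp: half_def)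
    then show False using f(2)[OF m(1)] f(3)[OF n(2)] m n by simp
  qed
qed

lemma collision_null: "collision \<in> null_sets (completion \<mu>)"
proof -
  have "pair_image L a b \<inter> pair_image L a b' \<in> null_sets (completion \<mu>)"
    if "L \<noteq> 0" "b \<noteq> b'" for L a b b'
  proof (rule ccontr)
    assume nn: "pair_image L a b \<inter> pair_image L a b' \<notin> null_sets (completion \<mu>)"
    have "pair_image L a b \<inter> pair_image L a b' \<in> sets (completion \<mu>)"
      using pair_image_in_completion by blast
    then obtain G where G: "G \<in> sets \<mu>" "G \<subseteq> pair_image L a b \<inter> pair_image L a b'"
        "emeasure \<mu> G \<noteq> 0"
      using nn by (rule completion_subset_positive)
    have "AE y in \<mu>. (\<forall>k. \<exists>n\<ge>k. iter n y \<in> G) \<and> (\<forall>k. \<exists>n\<le>k. iter n y \<in> G)"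
      using G(1,3) sets_mu by (intro iter_recurrence) auto
    then have "AE y in \<mu>. y \<in> space Y \<and> (\<forall>k. \<exists>n\<ge>k. iter n y \<in> G)"
      using AE_space by eventually_elim (auto simp: space_mu)
    then have "AE y in \<mu>. False"
    proof eventually_elim
      case (elim y)
      then show ?case using not_recurrent_collision[of y L b b' a] that G(2) by (meson subsetD)
    qed
    then show False by simp
  qed
  moreover have "countable {(L :: int, a, b, b'). L \<noteq> 0 \<and> a \<in> V \<and> b \<in> V \<and> b' \<in> V \<and> b \<noteq> b'}"
    by (rule countable_subset[of _ "UNIV \<times> V \<times> V \<times> V"]) (auto intro: countable_V)
  ultimately show ?thesis unfolding collision_def by (intro null_sets_UN') (auto split: prod.splits)
qed

lemma no_collision_imp_separated:
  assumes y: "y \<in> space Y" and nc: "\<And>n. iter n y \<notin> collision"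
    and x: "x \<in> fib y" "x' \<in> fib y" "x n = x' n"
  shows "x = x'"
proof (rule ccontr)
  assume "x \<noteq> x'"
  then obtain m where m: "x m \<noteq> x' m" by blast
  define L where "L = m - n"
  have L: "L \<noteq> 0" using m x(3) by (auto simp: L_def)
  have tr: "(\<lambda>k. w (k + n)) \<in> Z" "iter n y = p (\<lambda>k. w (k + n))" if "w \<in> fib y" for w
    using that p_translate translate_regular by (auto simp: fib_def)
  have "iter n y \<in> pair_image L (x n) (w m)" if "w \<in> fib y" "w n = x n" for w
    unfolding pair_image_def using tr[OF that(1)] that(2)
    by (intro image_eqI[of _ _ "\<lambda>k. w (k + n)"]) (auto simp: L_def)
  then have "iter n y \<in> pair_image L (x n) (x m) \<inter> pair_image L (x n) (x' m)" using x by simp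
  moreover have "x n \<in> V" "x m \<in> V" "x' m \<in> V"
    using x markov_V regular_imp_markov by (auto simp: fib_def)
  ultimately have "iter n y \<in> collision" unfolding collision_def using L m by blast
  with nc show False by blast
qed

lemma exists_recurrent_slice:
  obtains D G where "D \<in> Fpow V" "G \<in> sets Y" "emeasure \<mu> G \<noteq> 0"
    "\<And>y. y \<in> G \<Longrightarrow> fib y \<noteq> {} \<and> slice y 0 = D"
proof -
  define I where "I = (\<lambda>a. p ` (Z \<inter> {x. x 0 = a}))"
  define S where "S = (\<lambda>D. {y \<in> p ` Z. slice y 0 = D})"
  have I_sets: "I a \<in> sets (completion \<mu>)" for a
    unfolding I_def by (intro image_in_completion_mu cylinder_in_sets)
  have pZ: "p ` Z \<in> sets (completion \<mu>)" using image_in_completion_mu[of UNIV] by simp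
  have S_sets: "S D \<in> sets (completion \<mu>)" if D: "D \<in> Fpow V" for D
  proof -
    have DV: "D \<subseteq> V" "finite D" using D by (auto simp: Fpow_def)
    have mem: "a \<in> slice y 0 \<longleftrightarrow> y \<in> I a" for y a by (auto simp: slice_def I_def fib_def)
    have "slice y 0 \<subseteq> V" for y
      using markov_V regular_imp_markov by (auto simp: slice_def fib_def)
    then have "slice y 0 = D \<longleftrightarrow> (\<forall>a\<in>D. y \<in> I a) \<and> (\<forall>a\<in>V - D. y \<notin> I a)" for y
      using mem DV(1) by blast
    then have "S D = (p ` Z - (\<Union>a\<in>D. p ` Z - I a)) - (\<Union>a\<in>V - D. I a)"
      by (auto simp: S_def)
    also have "\<dots> \<in> sets (completion \<mu>)"
      using countable_finite[OF DV(2)] countable_V pZ I_sets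
      by (intro sets.Diff sets.countable_UN'' countable_Diff) auto
    finally show ?thesis .
  qed
  have "\<exists>D\<in>Fpow V. S D \<notin> null_sets (completion \<mu>)"
  proof (rule ccontr)
    assume "\<not> (\<exists>D\<in>Fpow V. S D \<notin> null_sets (completion \<mu>))"
    then have "(\<Union>D\<in>Fpow V. S D) \<in> null_sets (completion \<mu>)"
      using countable_Fpow[OF countable_V] by (intro null_sets_UN') auto
    moreover have "p ` Z \<subseteq> (\<Union>D\<in>Fpow V. S D)"
    proof
      fix y assume y: "y \<in> p ` Z"
      have "slice y 0 \<in> Fpow V"
        using finite_fib markov_V regular_imp_markov by (auto simp: Fpow_def slice_def fib_def)
      then show "y \<in> (\<Union>D\<in>Fpow V. S D)" using y by (auto simp: S_def)
    qed
    ultimately have "p ` Z \<in> null_sets (completion \<mu>)" using null_sets_completion_subset by blast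
    moreover have "p ` Z \<in> sets \<mu>" using full emeasure_notin_sets by fastforce
    ultimately have "emeasure \<mu> (p ` Z) = 0" by (simp add: null_sets_completion_iff null_setsD1)
    then show False using full by simp
  qed
  then obtain D where D: "D \<in> Fpow V" "S D \<notin> null_sets (completion \<mu>)" by blast
  obtain G where G: "G \<in> sets \<mu>" "G \<subseteq> S D" "emeasure \<mu> G \<noteq> 0"
    using completion_subset_positive[OF S_sets[OF D(1)] D(2)] .
  show thesis
  proof (rule that[OF D(1)])
    show "G \<in> sets Y" using G(1) sets_mu by simp
    show "emeasure \<mu> G \<noteq> 0" by (rule G(3))
    fix y assume "y \<in> G"
    then show "fib y \<noteq> {} \<and> slice y 0 = D" using G(2) by (auto simp: S_def fib_def)
  qed
qed

end

section \<open>The injective coding\<close>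

locale typical_coding = ergodic_coding V E Y T p R \<mu>
  for V :: "'a set" and E :: "'a rel" and Y :: "'y measure" and T :: "'y \<Rightarrow> 'y"
    and p :: "(int \<Rightarrow> 'a) \<Rightarrow> 'y" and R :: "'a rel" and \<mu> :: "'y measure" +
  fixes D0 :: "'a set" and G0 :: "'y set"
  assumes D0: "D0 \<in> Fpow V" and G0: "G0 \<in> sets Y" "emeasure \<mu> G0 \<noteq> 0"
    and G0_slice: "\<And>y. y \<in> G0 \<Longrightarrow> fib y \<noteq> {} \<and> slice y 0 = D0"
begin

definition \<delta> :: "nat \<Rightarrow> 'a set" where "\<delta> = from_nat_into (Fpow V)"

definition code :: "'a set \<Rightarrow> nat" where "code = to_nat_on (Fpow V)"

definition matching :: "'a set \<Rightarrow> 'a set \<Rightarrow> bool"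
  where "matching D D' \<longleftrightarrow> (\<forall>d\<in>D. \<exists>!d'. d' \<in> D' \<and> (d, d') \<in> E) \<and> (\<forall>d'\<in>D'. \<exists>!d. d \<in> D \<and> (d, d') \<in> E)"

definition V1 :: "nat set"
  where "V1 = code ` {D \<in> Fpow V. D \<noteq> {} \<and> card D = card D0 \<and> (\<forall>d\<in>D. \<forall>d'\<in>D. (d, d') \<in> R)}"

definition E1 :: "nat rel" where "E1 = {(i, j). i \<in> V1 \<and> j \<in> V1 \<and> matching (\<delta> i) (\<delta> j)}"

definition V2 :: "nat set" where "V2 = {i. (code D0, i) \<in> E1\<^sup>+ \<and> (i, code D0) \<in> E1\<^sup>+}"

definition E2 :: "nat rel" where "E2 = E1 \<inter> V2 \<times> V2"

lemma \<delta>_code: "D \<in> Fpow V \<Longrightarrow> \<delta> (code D) = D"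
  unfolding \<delta>_def code_def using countable_Fpow[OF countable_V] by simp

lemma V1_\<delta>:
  assumes "i \<in> V1"
  shows "\<delta> i \<in> Fpow V" "\<delta> i \<noteq> {}" "card (\<delta> i) = card D0" "code (\<delta> i) = i"
    "\<And>d d'. d \<in> \<delta> i \<Longrightarrow> d' \<in> \<delta> i \<Longrightarrow> (d, d') \<in> R"
  using assms by (auto simp: V1_def \<delta>_code)

lemma V2_V1: "V2 \<subseteq> V1"
proof
  fix i assume "i \<in> V2"
  then have "(code D0, i) \<in> E1\<^sup>+" by (simp add: V2_def)
  then show "i \<in> V1" by (induction rule: trancl_induct) (auto simp: E1_def)
qed

sublocale sg: strand_graph V E Y T p R V2 E2 \<delta>
proof unfold_locales
  show "countable_graph V2 E2" by (auto simp: countable_graph_def E2_def)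
  show "inj_on \<delta> V2" by (rule inj_on_inverseI[of _ code]) (use V2_V1 V1_\<delta>(4) in blast)
  show "\<delta> i \<subseteq> V" "finite (\<delta> i)" "\<delta> i \<noteq> {}" if "i \<in> V2" for i
    using V1_\<delta>[of i] that V2_V1 by (auto simp: Fpow_def)
  show "(d, d') \<in> R" if "i \<in> V2" "d \<in> \<delta> i" "d' \<in> \<delta> i" for i d d'
    using V1_\<delta>(5) that V2_V1 by blast
  show "\<exists>!d'. d' \<in> \<delta> j \<and> (d, d') \<in> E" if "(i, j) \<in> E2" "d \<in> \<delta> i" for i j d
    using that by (auto simp: E2_def E1_def matching_def)
  show "\<exists>!d. d \<in> \<delta> i \<and> (d, d') \<in> E" if "(i, j) \<in> E2" "d' \<in> \<delta> j" for i j d'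
    using that by (auto simp: E2_def E1_def matching_def)
qed

lemma irreducible: "irreducible_graph V2 E2"
  unfolding irreducible_graph_def
proof (intro ballI)
  fix i j assume i: "i \<in> V2" and j: "j \<in> V2"
  have "(i, j) \<in> E1\<^sup>+" using i j trancl_trans unfolding V2_def by fast
  then have "(j, code D0) \<in> E1\<^sup>+ \<longrightarrow> (i, j) \<in> E2\<^sup>+ \<and> j \<in> V2"
  proof (induction rule: trancl_induct)
    case (base k)
    have "(code D0, k) \<in> E1\<^sup>+" using i base by (auto simp: V2_def intro: trancl_into_trancl)
    then show ?case using base i by (auto simp: V2_def E2_def)
  next
    case (step k l)
    show ?case
    proof
      assume l: "(l, code D0) \<in> E1\<^sup>+"
      then have "(k, code D0) \<in> E1\<^sup>+" using step.hyps(2) by (rule trancl_into_trancl2[rotated])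
      with step.IH have k: "(i, k) \<in> E2\<^sup>+" "k \<in> V2" by auto
      then have "(code D0, l) \<in> E1\<^sup>+" using step.hyps(2) by (auto simp: V2_def intro: trancl_into_trancl)
      then have "l \<in> V2" using l by (simp add: V2_def)
      then show "(i, l) \<in> E2\<^sup>+ \<and> l \<in> V2"
        using k step.hyps(2) by (auto simp: E2_def intro: trancl_into_trancl)
    qed
  qed
  then show "(i, j) \<in> E2\<^sup>+" using j by (simp add: V2_def)
qed

definition typical :: "'y \<Rightarrow> bool"
  where "typical y \<longleftrightarrow> y \<in> space Y \<and> (\<forall>n. iter n y \<notin> collision) \<and>
    (\<forall>k. \<exists>n\<ge>k. iter n y \<in> G0) \<and> (\<forall>k. \<exists>n\<le>k. iter n y \<in> G0)"

definition lift :: "'y \<Rightarrow> int \<Rightarrow> nat" where "lift y n = code (slice y n)"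

lemma typical_separated:
  "typical y \<Longrightarrow> x \<in> fib y \<Longrightarrow> x' \<in> fib y \<Longrightarrow> x n = x' n \<Longrightarrow> x = x'"
  using no_collision_imp_separated[of y x x' n] unfolding typical_def by blast

lemma typical_inj: "typical y \<Longrightarrow> inj_on (\<lambda>x. x n) (fib y)"
  using typical_separated by (auto intro: inj_onI)

lemma typical_visits:
  assumes "typical y" "iter n y \<in> G0"
  shows "slice y n = D0" "fib y \<noteq> {}"
  using assms G0_slice[OF assms(2)] slice_iter[of y n 0] fib_iter[of y n]
  by (auto simp: typical_def)

lemma typical_card_slice:
  assumes "typical y"
  shows "card (slice y n) = card D0" "slice y n \<noteq> {}" "card (fib y) = card D0"
proof -
  obtain m where "iter m y \<in> G0" using assms unfolding typical_def by blast
  note m = typical_visits[OF assms this]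
  have card: "card (slice y k) = card (fib y)" for k
    unfolding slice_def by (rule card_image[OF typical_inj[OF assms]])
  show "card (fib y) = card D0" using card[of m] m(1) by simp
  then show "card (slice y n) = card D0" using card[of n] by simp
  show "slice y n \<noteq> {}" using m(2) by (simp add: slice_def)
qed

lemma slice_Fpow: "slice y n \<in> Fpow V"
  using finite_fib markov_V regular_imp_markov by (auto simp: Fpow_def slice_def fib_def)

lemma lift_V1: "typical y \<Longrightarrow> lift y n \<in> V1"
  unfolding lift_def V1_def using slice_Fpow typical_card_slice fib_related
  by (intro imageI CollectI conjI) (auto simp: slice_def)

lemma \<delta>_lift: "\<delta> (lift y n) = slice y n"
  unfolding lift_def by (rule \<delta>_code[OF slice_Fpow])

text \<open>An edge between slices that does not come from a single point of the fiber would splice two of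
  its points into a third one meeting them.\<close>

lemma typical_edge:
  assumes y: "typical y" and x: "x \<in> fib y" "x' \<in> fib y" and e: "(x n, x' (n + 1)) \<in> E"
  shows "x = x'"
proof -
  let ?w = "\<lambda>k. if k \<le> n then x k else x' k"
  have w: "?w \<in> fib y" by (rule splice_in_fib[OF x e])
  have "?w = x" using typical_separated[OF y w x(1), of n] by simp
  moreover have "?w = x'" using typical_separated[OF y w x(2), of "n + 1"] by simp
  ultimately show ?thesis by simp
qed

lemma fib_edge: "x \<in> fib y \<Longrightarrow> (x n, x (n + 1)) \<in> E"
  using regular_imp_markov by (auto simp: fib_def markov_shift_def)

lemma lift_E1:
  assumes "typical y"
  shows "lift y \<in> markov_shift E1"
proof -
  have "matching (slice y n) (slice y (n + 1))" for n
    unfolding matching_def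
  proof (intro conjI ballI)
    fix d assume "d \<in> slice y n"
    then obtain x where x: "x \<in> fib y" "d = x n" by (auto simp: slice_def)
    show "\<exists>!d'. d' \<in> slice y (n + 1) \<and> (d, d') \<in> E"
    proof (rule ex1I[of _ "x (n + 1)"])
      show "x (n + 1) \<in> slice y (n + 1) \<and> (d, x (n + 1)) \<in> E"
        using x fib_edge by (simp add: slice_def)
      fix d' assume d': "d' \<in> slice y (n + 1) \<and> (d, d') \<in> E"
      then obtain x' where "x' \<in> fib y" "d' = x' (n + 1)" by (auto simp: slice_def)
      then show "d' = x (n + 1)" using typical_edge[OF assms x(1), of x' n] x(2) d' by simp
    qed
  next
    fix d' assume "d' \<in> slice y (n + 1)"
    then obtain x where x: "x \<in> fib y" "d' = x (n + 1)" by (auto simp: slice_def)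
    show "\<exists>!d. d \<in> slice y n \<and> (d, d') \<in> E"
    proof (rule ex1I[of _ "x n"])
      show "x n \<in> slice y n \<and> (x n, d') \<in> E" using x fib_edge by (simp add: slice_def)
      fix d assume d: "d \<in> slice y n \<and> (d, d') \<in> E"
      then obtain x' where "x' \<in> fib y" "d = x' n" by (auto simp: slice_def)
      then show "d = x n" using typical_edge[OF assms _ x(1), of x' n] x(2) d by simp
    qed
  qed
  then show ?thesis using lift_V1[OF assms] by (simp add: markov_shift_def E1_def \<delta>_lift)
qed

lemma lift_E2:
  assumes "typical y"
  shows "lift y \<in> markov_shift E2"
proof -
  have "lift y n \<in> V2" for n
  proof -
    obtain k where k: "k \<ge> n + 1" "iter k y \<in> G0" using assms unfolding typical_def by blast
    obtain m where m: "m \<le> n - 1" "iter m y \<in> G0" using assms unfolding typical_def by blast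
    have "lift y k = code D0" "lift y m = code D0"
      using typical_visits(1)[OF assms] k m by (auto simp: lift_def)
    then show ?thesis
      using markov_shift_trancl[OF lift_E1[OF assms], of m n]
        markov_shift_trancl[OF lift_E1[OF assms], of n k] k m
      by (simp add: V2_def)
  qed
  then show ?thesis using lift_E1[OF assms] by (simp add: markov_shift_def E2_def)
qed

lemma lift_regular:
  assumes "typical y"
  shows "lift y \<in> sg.Z'" "sg.p' (lift y) = y"
proof -
  obtain m where "iter m y \<in> G0" using assms unfolding typical_def by blast
  then obtain x where x: "x \<in> fib y" using typical_visits(2)[OF assms] by blast
  then have s: "x \<in> sg.strands (lift y)"
    using regular_imp_markov by (auto simp: sg.strands_def \<delta>_lift slice_def fib_def)
  show l: "lift y \<in> sg.Z'"
    using sg.regular_if_strand_regular[OF lift_E2[OF assms] s] x by (simp add: fib_def)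
  show "sg.p' (lift y) = y" using sg.strands_same_image[OF l s] x by (simp add: fib_def)
qed

lemma lift_unique:
  assumes y: "typical y" and z: "z \<in> sg.Z'" "sg.p' z = y"
  shows "z = lift y"
proof
  fix n
  have mk: "z \<in> markov_shift E2" using z(1) by (rule sg.regular_imp_markov')
  then have V1: "z n \<in> V1" for n using sg.markov_V' V2_V1 by blast
  have sub: "sg.strands z \<subseteq> fib y" using sg.strands_subset_fib[OF z(1)] z(2) by simp
  have "card (\<delta> (z 0)) \<le> card (sg.strands z)"
    unfolding sg.\<delta>_eq_strands[OF mk] by (rule card_image_le[OF finite_subset[OF sub finite_fib]])
  then have "card (fib y) \<le> card (sg.strands z)"
    using V1_\<delta>(3)[OF V1] typical_card_slice(3)[OF y] by simp
  then have "sg.strands z = fib y" using sub finite_fib by (metis card_seteq)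
  then have "\<delta> (z n) = slice y n" using sg.\<delta>_eq_strands[OF mk] by (simp add: slice_def)
  then show "z n = lift y n" using V1_\<delta>(4)[OF V1, of n] by (simp add: lift_def)
qed

lemma lift_T:
  assumes "typical y"
  shows "lift (T y) = shift_map (lift y)"
proof -
  have "y \<in> space Y" using assms by (simp add: typical_def)
  then have "slice (T y) n = slice y (n + 1)" for n
    using slice_iter[of y 1 n] iter_plus_1[of y 0] by simp
  then show ?thesis by (simp add: lift_def shift_map_def fun_eq_iff)
qed

end

context typical_coding
begin

abbreviation X2 :: "(int \<Rightarrow> nat) set" where "X2 \<equiv> markov_shift E2"

abbreviation MX :: "(int \<Rightarrow> nat) measure" where "MX \<equiv> borel_of (symb_topology X2)"

lemma countable_nat_set: "countable (S :: nat set)"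
  by (rule countable_subset[OF subset_UNIV]) simp

lemma sg_Z_in_sets: "sg.Z' \<in> sets cylinder_algebra"
  by (intro regular_part_in_sets markov_shift_in_sets countable_nat_set)
    (rule countable_subset[OF subset_UNIV], simp)

lemma sets_MX: "sets MX = sets (restrict_space cylinder_algebra X2)"
  by (rule sets_borel_of_symb_topology[of UNIV]) auto

lemma sg_p'_measurable: "sg.p' \<in> measurable (borel_of (symb_topology sg.Z')) Y"
  using sg.excellent_p' by (simp add: excellent_semiconjugacy_def)

lemma sg_vimage_in_sets:
  assumes "C \<in> sets Y"
  shows "sg.p' -` C \<inter> sg.Z' \<in> sets MX"
proof -
  have "sg.p' -` C \<inter> sg.Z' \<in> sets (borel_of (symb_topology sg.Z'))"
    using measurable_sets[OF sg_p'_measurable assms] by simp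
  also have "\<dots> = sets (restrict_space cylinder_algebra sg.Z')"
    by (rule sets_borel_of_symb_topology[of UNIV]) auto
  finally obtain D where D: "D \<in> sets cylinder_algebra" "sg.p' -` C \<inter> sg.Z' = sg.Z' \<inter> D"
    by (auto simp: sets_restrict_space)
  have "sg.Z' \<inter> D = X2 \<inter> (sg.Z' \<inter> D)" using sg.regular_imp_markov' by blast
  then show ?thesis
    using D sg_Z_in_sets unfolding sets_MX sets_restrict_space by blast
qed

lemma sg_image_in_completion: "sg.p' ` (sg.Z' \<inter> {z. z n = k}) \<in> sets (completion \<mu>)"
  by (rule image_in_completion[OF standard _ _ sg_Z_in_sets sg_p'_measurable cylinder_in_sets
        finite_measure_axioms sets_mu, of UNIV]) auto

lemma shift_measurable: "shift_map \<in> measurable MX MX"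
proof (rule continuous_map_imp_measurable_borel_of, rule continuous_map_symb_topologyI)
  show "shift_map ` X2 \<subseteq> X2" using shift_markov[of _ E2 1] by (auto simp: shift_map_def)
  show "\<exists>k. \<forall>y\<in>X2. agree k x y \<longrightarrow> agree m (shift_map x) (shift_map y)" for x m
    by (rule exI[of _ "Suc m"]) (auto simp: agree_def shift_map_def)
qed

text \<open>Removing a further null set makes the images of the countably many cylinders Borel, hence the
  lift measurable.\<close>

lemma exists_good_set:
  obtains B where "B \<in> sets Y" "AE y in \<mu>. y \<in> B" "\<And>y. y \<in> B \<Longrightarrow> typical y"
    "\<And>y. y \<in> space Y \<Longrightarrow> T y \<in> B \<longleftrightarrow> y \<in> B"
    "\<And>n k. B \<inter> sg.p' ` (sg.Z' \<inter> {z. z n = k}) \<in> sets Y"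
proof -
  obtain N1 where N1: "N1 \<in> null_sets \<mu>" "collision \<subseteq> N1"
    using collision_null unfolding null_sets_completion_iff2 by (elim bexE)
  define A where "A = (\<lambda>(n, k). sg.p' ` (sg.Z' \<inter> {z. z n = k}))"
  have "A i \<in> sets (completion \<mu>)" for i
    using sg_image_in_completion by (auto simp: A_def split: prod.splits)
  then obtain N2 where N2: "N2 \<in> null_sets \<mu>" "\<And>i. A i - N2 \<in> sets \<mu>"
    using completion_common_null_set[of A \<mu>] by blast
  define N where "N = N1 \<union> N2"
  have N: "N \<in> null_sets \<mu>" unfolding N_def using N1(1) N2(1) by blast
  define B where "B = {y \<in> space Y. (\<forall>n. iter n y \<notin> N) \<and>
    (\<forall>k. \<exists>n\<ge>k. iter n y \<in> G0) \<and> (\<forall>k. \<exists>n\<le>k. iter n y \<in> G0)}"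
  have N_sets: "N \<in> sets Y" using N sets_mu by auto
  show thesis
  proof
    define P1 P2 P3 where "P1 = (\<lambda>n. space Y - (iter n -` N \<inter> space Y))"
      and "P2 = (\<lambda>k. \<Union>n\<in>{k..}. iter n -` G0 \<inter> space Y)"
      and "P3 = (\<lambda>k. \<Union>n\<in>{..k}. iter n -` G0 \<inter> space Y)"
    have P: "P1 n \<in> sets Y" "P2 n \<in> sets Y" "P3 n \<in> sets Y" for n
      unfolding P1_def P2_def P3_def
      using measurable_sets[OF iter_measurable N_sets] measurable_sets[OF iter_measurable G0(1)]
      by (intro sets.countable_UN'' sets.compl_sets; simp)+
    have "B = (\<Inter>n. P1 n) \<inter> (\<Inter>k. P2 k) \<inter> (\<Inter>k. P3 k)"
      by (auto simp: B_def P1_def P2_def P3_def) blast+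
    also have "\<dots> \<in> sets Y"
      using P by (intro sets.Int sets.countable_INT') auto
    finally show B_sets: "B \<in> sets Y" .
    have "AE y in \<mu>. \<forall>n. y \<notin> iter n -` N \<inter> space Y"
      unfolding AE_all_countable using AE_not_in[OF iter_null_sets[OF N]] by blast
    then show "AE y in \<mu>. y \<in> B"
      using iter_recurrence[OF G0] AE_space
    proof eventually_elim
      case (elim y)
      then show ?case by (auto simp: B_def space_mu)
    qed
    show "typical y" if "y \<in> B" for y
      using that N1(2) by (auto simp: typical_def B_def N_def)
    show "T y \<in> B \<longleftrightarrow> y \<in> B" if y: "y \<in> space Y" for y
    proof -
      have "(\<forall>n. iter (n + 1) y \<notin> N) \<longleftrightarrow> (\<forall>n. iter n y \<notin> N)"
        by (metis diff_add_cancel)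
      moreover have "(\<forall>k. \<exists>n\<ge>k. iter (n + 1) y \<in> G0) \<longleftrightarrow> (\<forall>k. \<exists>n\<ge>k. iter n y \<in> G0)"
      proof (intro iffI allI)
        fix k assume "\<forall>k. \<exists>n\<ge>k. iter (n + 1) y \<in> G0"
        then obtain n where "n \<ge> k" "iter (n + 1) y \<in> G0" by blast
        then show "\<exists>n\<ge>k. iter n y \<in> G0" by (intro exI[of _ "n + 1"]) simp
      next
        fix k assume "\<forall>k. \<exists>n\<ge>k. iter n y \<in> G0"
        then obtain n where "n \<ge> k + 1" "iter n y \<in> G0" by blast
        then show "\<exists>n\<ge>k. iter (n + 1) y \<in> G0" by (intro exI[of _ "n - 1"]) simp
      qed
      moreover have "(\<forall>k. \<exists>n\<le>k. iter (n + 1) y \<in> G0) \<longleftrightarrow> (\<forall>k. \<exists>n\<le>k. iter n y \<in> G0)"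
      proof (intro iffI allI)
        fix k assume "\<forall>k. \<exists>n\<le>k. iter (n + 1) y \<in> G0"
        then obtain n where "n \<le> k - 1" "iter (n + 1) y \<in> G0" by blast
        then show "\<exists>n\<le>k. iter n y \<in> G0" by (intro exI[of _ "n + 1"]) simp
      next
        fix k assume "\<forall>k. \<exists>n\<le>k. iter n y \<in> G0"
        then obtain n where "n \<le> k" "iter n y \<in> G0" by blast
        then show "\<exists>n\<le>k. iter (n + 1) y \<in> G0" by (intro exI[of _ "n - 1"]) simp
      qed
      ultimately show ?thesis using y T_space[OF y] by (simp add: B_def iter_T)
    qed
    show "B \<inter> sg.p' ` (sg.Z' \<inter> {z. z n = k}) \<in> sets Y" for n k
    proof -
      have "y \<notin> N2" if "y \<in> B" for y
      proof -
        have "iter 0 y \<notin> N" using that unfolding B_def by blast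
        then show ?thesis by (simp add: N_def)
      qed
      then have "B \<inter> sg.p' ` (sg.Z' \<inter> {z. z n = k}) = B \<inter> (A (n, k) - N2)"
        by (auto simp: A_def)
      then show ?thesis using B_sets N2(2)[of "(n, k)"] sets_mu by auto
    qed
  qed
qed

lemma unique_preimage: "AE y in \<mu>. card {x \<in> sg.Z'. sg.p' x = y} = 1"
proof -
  obtain B where B: "AE y in \<mu>. y \<in> B" "\<And>y. y \<in> B \<Longrightarrow> typical y"
    using exists_good_set by metis
  show ?thesis using B(1)
  proof eventually_elim
    case (elim y)
    then have "{x \<in> sg.Z'. sg.p' x = y} = {lift y}"
      using lift_regular[OF B(2)] lift_unique[OF B(2)] by blast
    then show ?case by simp
  qed
qed

lemma lifted_measure:
  "\<exists>\<nu>. ergodic_measure MX shift_map \<nu> \<and> mps_isomorphism sg.Z' \<nu> shift_map \<mu> T sg.p'"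
proof -
  obtain B where B_sets: "B \<in> sets Y" and B_AE: "AE y in \<mu>. y \<in> B"
    and B_typ: "\<And>y. y \<in> B \<Longrightarrow> typical y"
    and B_T: "\<And>y. y \<in> space Y \<Longrightarrow> T y \<in> B \<longleftrightarrow> y \<in> B"
    and B_img: "\<And>n k. B \<inter> sg.p' ` (sg.Z' \<inter> {z. z n = k}) \<in> sets Y"
    using exists_good_set by metis
  have B_space: "B \<subseteq> space Y" using B_sets by (rule sets.sets_into_space)
  have "B \<noteq> {}" using B_AE by (auto dest: eventually_mono[of _ _ "\<lambda>_. False"])
  then obtain y0 where y0: "y0 \<in> B" by blast
  define s where "s = (\<lambda>y. if y \<in> B then lift y else lift y0)"
  have sB: "s y = lift y" if "y \<in> B" for y using that by (simp add: s_def)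
  have lift: "lift y \<in> sg.Z'" "sg.p' (lift y) = y" "lift y \<in> X2" if "y \<in> B" for y
    using lift_regular[OF B_typ[OF that]] lift_E2[OF B_typ[OF that]] by auto
  have lift_cyl: "lift y n = k \<longleftrightarrow> y \<in> sg.p' ` (sg.Z' \<inter> {z. z n = k})" if "y \<in> B" for y n k
  proof
    assume "lift y n = k"
    then show "y \<in> sg.p' ` (sg.Z' \<inter> {z. z n = k})"
      using lift[OF that] by (intro image_eqI[of _ _ "lift y"]) auto
  next
    assume "y \<in> sg.p' ` (sg.Z' \<inter> {z. z n = k})"
    then obtain z where z: "z \<in> sg.Z'" "sg.p' z = y" "z n = k" by blast
    then show "lift y n = k" using lift_unique[OF B_typ[OF that] z(1,2)] by simp
  qed
  have s_X2: "s y \<in> X2" for y using lift(3) y0 by (simp add: s_def)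
  have "s \<in> measurable \<mu> cylinder_algebra"
    unfolding cylinder_algebra_def
  proof (rule measurable_measure_of)
    fix C :: "(int \<Rightarrow> nat) set" assume "C \<in> range (\<lambda>(n, a). {x. x n = a})"
    then obtain n k where C: "C = {x. x n = k}" by auto
    have "s -` C \<inter> space \<mu> = (B \<inter> sg.p' ` (sg.Z' \<inter> {z. z n = k})) \<union>
        (if lift y0 n = k then space Y - B else {})"
      using lift_cyl B_space by (auto simp: C s_def space_mu split: if_splits)
    also have "\<dots> \<in> sets \<mu>" using B_img B_sets sets_mu by auto
    finally show "s -` C \<inter> space \<mu> \<in> sets \<mu>" .
  qed auto
  then have "s \<in> measurable \<mu> (restrict_space cylinder_algebra X2)"
    using s_X2 by (intro measurable_restrict_space2) auto
  then have s_meas: "s \<in> measurable \<mu> MX"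
    by (simp cong: measurable_cong_sets add: sets_MX)
  define \<nu> where "\<nu> = distr \<mu> MX s"
  have nu_sets: "sets \<nu> = sets MX" by (simp add: \<nu>_def)
  have nu_space: "space \<nu> = X2" by (simp add: \<nu>_def)
  have nu: "emeasure \<nu> C = emeasure \<mu> {y \<in> B. lift y \<in> C}"
    and pre_sets: "{y \<in> B. lift y \<in> C} \<in> sets Y" if C: "C \<in> sets MX" for C
  proof -
    have pre: "s -` C \<inter> space \<mu> \<in> sets \<mu>" using s_meas C by (rule measurable_sets)
    have eq: "{y \<in> B. lift y \<in> C} = B \<inter> (s -` C \<inter> space \<mu>)"
      using B_space space_mu by (auto simp: sB)
    show sets: "{y \<in> B. lift y \<in> C} \<in> sets Y" unfolding eq using pre B_sets sets_mu by auto
    have "emeasure \<nu> C = emeasure \<mu> (s -` C \<inter> space \<mu>)"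
      unfolding \<nu>_def using s_meas C by (rule emeasure_distr)
    also have "\<dots> = emeasure \<mu> {y \<in> B. lift y \<in> C}"
    proof (rule emeasure_eq_AE)
      show "AE y in \<mu>. y \<in> s -` C \<inter> space \<mu> \<longleftrightarrow> y \<in> {y \<in> B. lift y \<in> C}"
        using B_AE AE_space by eventually_elim (auto simp: sB)
    qed (use pre sets sets_mu in auto)
    finally show "emeasure \<nu> C = emeasure \<mu> {y \<in> B. lift y \<in> C}" .
  qed
  have shift_pre: "{y \<in> B. lift y \<in> shift_map -` C \<inter> X2} = T -` {y \<in> B. lift y \<in> C} \<inter> space Y" for C
    using lift(3) lift_T[OF B_typ] B_T B_space by auto
  have "ergodic_measure MX shift_map \<nu>"
    unfolding ergodic_measure_def
  proof (intro conjI ballI impI)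
    show "prob_space \<nu>" unfolding \<nu>_def by (rule prob_space_distr[OF s_meas])
    show "sets \<nu> = sets MX" by (rule nu_sets)
    fix C assume C: "C \<in> sets MX"
    have "shift_map -` C \<inter> X2 \<in> sets MX" using measurable_sets[OF shift_measurable C] by simp
    from nu[OF this] show "emeasure \<nu> (shift_map -` C \<inter> space MX) = emeasure \<nu> C"
      unfolding shift_pre T_invariant[OF pre_sets[OF C]] by (simp add: nu[OF C])
    assume "shift_map -` C \<inter> space MX = C"
    then have "T -` {y \<in> B. lift y \<in> C} \<inter> space Y = {y \<in> B. lift y \<in> C}"
      using shift_pre[of C] by (simp only: space_borel_of topspace_symb_topology)
    then show "emeasure \<nu> C = 0 \<or> emeasure \<nu> C = 1"
      using erg pre_sets[OF C] nu[OF C] by (simp add: ergodic_measure_def)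
  qed
  moreover have "mps_isomorphism sg.Z' \<nu> shift_map \<mu> T sg.p'"
  proof -
    define A where "A = sg.p' -` B \<inter> sg.Z'"
    have A_lift: "A = lift ` B"
    proof (intro equalityI subsetI)
      fix z assume z: "z \<in> A"
      then have "z = lift (sg.p' z)" using lift_unique[OF B_typ, of "sg.p' z" z] by (simp add: A_def)
      then show "z \<in> lift ` B" using z by (auto simp: A_def)
    qed (use lift in \<open>auto simp: A_def\<close>)
    have A_sets: "A \<in> sets MX" unfolding A_def by (rule sg_vimage_in_sets[OF B_sets])
    have inj: "inj_on sg.p' A" unfolding A_lift using lift by (auto intro: inj_onI)
    have inv: "the_inv_into A sg.p' y = lift y" if "y \<in> B" for y
      using the_inv_into_f_f[OF inj, of "lift y"] lift[OF that] that A_lift by auto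
    have TB: "T ` B = B"
    proof (intro equalityI subsetI)
      fix y assume y: "y \<in> B"
      then have "Tinv y \<in> B" using B_T[of "Tinv y"] B_space Tinv_space T_Tinv by auto
      then show "y \<in> T ` B" using T_Tinv[of y] y B_space by (metis image_eqI subsetD)
    qed (use B_T B_space in auto)
    have rA: "W \<in> sets (restrict_space \<nu> A) \<longleftrightarrow> W \<subseteq> A \<and> W \<in> sets MX" for W
      using A_sets nu_sets sets_restrict_space_iff[of A \<nu> W] nu_space sets.sets_into_space[OF A_sets]
      by (simp add: Int_absorb2)
    have rB: "W \<in> sets (restrict_space \<mu> B) \<longleftrightarrow> W \<subseteq> B \<and> W \<in> sets Y" for W
      using B_sets sets_mu sets_restrict_space_iff[of B \<mu> W] B_space space_mu
      by (simp add: Int_absorb2)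
    have sp: "space (restrict_space \<nu> A) = A" "space (restrict_space \<mu> B) = B"
      using sets.sets_into_space[OF A_sets] nu_space B_space space_mu
      by (auto simp: space_restrict_space)
    have pA: "sg.p' z \<in> B" if "z \<in> A" for z using that by (simp add: A_def)
    have invA: "the_inv_into A sg.p' y \<in> A" if "y \<in> B" for y
      unfolding inv[OF that] by (simp add: A_lift that)
    show ?thesis
      unfolding mps_isomorphism_def
    proof (intro bexI[of _ A] bexI[of _ B] conjI ballI impI)
      show "A \<subseteq> sg.Z'" by (simp add: A_def)
      have empty: "{y \<in> B. lift y \<in> X2 - A} = {}" using A_lift by blast
      have "X2 - A \<in> sets MX" using sets.compl_sets[OF A_sets] by simp
      from nu[OF this] show "emeasure \<nu> (space \<nu> - A) = 0" unfolding empty nu_space by simp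
      show "emeasure \<mu> (space \<mu> - B) = 0"
        unfolding set_diff_eq by (rule emeasure_eq_0_AE) (use B_AE in simp)
      show "T ` B = B" by (rule TB)
      have "shift_map ` A = lift ` T ` B"
        unfolding A_lift image_image by (rule image_cong[OF refl]) (simp add: lift_T B_typ)
      then show "shift_map ` A = A" using TB A_lift by simp
      show "bij_betw sg.p' A B"
        using inj lift(2) by (auto simp: bij_betw_def A_lift image_image)
      show "sg.p' \<in> measurable (restrict_space \<nu> A) (restrict_space \<mu> B)"
      proof (rule measurableI)
        fix W assume "W \<in> sets (restrict_space \<mu> B)"
        then have W: "W \<subseteq> B" "W \<in> sets Y" by (auto simp: rB)
        have "sg.p' -` W \<inter> A = sg.p' -` W \<inter> sg.Z'" using W(1) by (auto simp: A_def)
        then show "sg.p' -` W \<inter> space (restrict_space \<nu> A) \<in> sets (restrict_space \<nu> A)"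
          using sg_vimage_in_sets[OF W(2)] by (auto simp: rA sp)
      qed (simp_all add: sp pA)
      show "the_inv_into A sg.p' \<in> measurable (restrict_space \<mu> B) (restrict_space \<nu> A)"
      proof (rule measurableI)
        fix W assume "W \<in> sets (restrict_space \<nu> A)"
        then have W: "W \<in> sets MX" by (auto simp: rA)
        have "the_inv_into A sg.p' -` W \<inter> B = {y \<in> B. lift y \<in> W}" by (auto simp: inv)
        then show "the_inv_into A sg.p' -` W \<inter> space (restrict_space \<mu> B) \<in> sets (restrict_space \<mu> B)"
          using pre_sets[OF W] by (auto simp: rB sp)
      qed (simp_all add: sp invA)
      show "sg.p' (shift_map x) = T (sg.p' x)" if "x \<in> A" for x
        using that sg.p'_shift by (simp add: A_def)
      show "emeasure \<nu> (sg.p' -` C \<inter> A) = emeasure \<mu> C" if C: "C \<in> sets \<mu>" "C \<subseteq> B" for C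
      proof -
        have eq: "sg.p' -` C \<inter> A = sg.p' -` C \<inter> sg.Z'" using C(2) by (auto simp: A_def)
        have "sg.p' -` C \<inter> A \<in> sets MX" unfolding eq using C(1) sets_mu by (intro sg_vimage_in_sets) simp
        note nu[OF this]
        moreover have "y \<in> B \<and> lift y \<in> sg.p' -` C \<inter> A \<longleftrightarrow> y \<in> C" for y
          using subsetD[OF C(2), of y] lift(2)[of y] by (cases "y \<in> B") (auto simp: A_lift)
        then have "{y \<in> B. lift y \<in> sg.p' -` C \<inter> A} = C" by blast
        ultimately show ?thesis by simp
      qed
      show "B \<in> sets \<mu>" using B_sets sets_mu by simp
      show "A \<in> sets \<nu>" using A_sets nu_sets by simp
    qed
  qed
  ultimately show ?thesis by blast
qed

end

theorem theorem5p2: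
  fixes V :: "'a set" and E :: "'a rel"
    and Y :: "'y measure" and T :: "'y \<Rightarrow> 'y"
    and \<pi> :: "(int \<Rightarrow> 'a) \<Rightarrow> 'y" and \<mu> :: "'y measure"
  assumes "countable_graph V E"
    and "dynamical_system Y T"
    and "excellent_semiconjugacy V (markov_regular V E) Y T \<pi>"
    and "ergodic_measure Y T \<mu>"
    and "emeasure \<mu> (\<pi> ` markov_regular V E) = 1"
  shows "\<exists>(V' :: nat set) (E' :: nat rel) (\<pi>' :: (int \<Rightarrow> nat) \<Rightarrow> 'y)
      (q :: (int \<Rightarrow> nat) \<Rightarrow> (int \<Rightarrow> 'a)).
    countable_graph V' E' \<and>
    \<comment> \<open>(1)\<close>
    excellent_semiconjugacy V' (markov_regular V' E') Y T \<pi>' \<and>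
    ((\<exists>C. multiplicity_bound V (markov_regular V E) \<pi> C) \<longrightarrow>
      (\<exists>C'. multiplicity_bound V' (markov_regular V' E') \<pi>' C')) \<and>
    \<comment> \<open>(2)\<close>
    (locally_compact_space (symb_topology (markov_shift E)) \<longrightarrow>
      locally_compact_space (symb_topology (markov_shift E'))) \<and>
    \<comment> \<open>(3)\<close>
    q ` markov_shift E' \<subseteq> markov_shift E \<and>
    one_lipschitz_on (markov_shift E') q \<and>
    q ` markov_regular V' E' \<subseteq> markov_regular V E \<and>
    (\<forall>x\<in>markov_regular V' E'. \<pi>' x = \<pi> (q x)) \<and>
    \<comment> \<open>(4)\<close>
    (\<forall>K. compactin (symb_topology (markov_regular V E)) K \<longrightarrow>
      compactin (symb_topology (markov_regular V' E')) (q -` K \<inter> markov_regular V' E')) \<and>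
    \<comment> \<open>(5)\<close>
    \<pi>' ` markov_regular V' E' \<subseteq> \<pi> ` markov_regular V E \<and>
    (AE y in \<mu>. card {x\<in>markov_regular V' E'. \<pi>' x = y} = 1) \<and>
    \<comment> \<open>(6)\<close>
    (\<exists>\<mu>'. ergodic_measure (borel_of (symb_topology (markov_shift E'))) shift_map \<mu>' \<and>
      mps_isomorphism (markov_regular V' E') \<mu>' shift_map \<mu> T \<pi>') \<and>
    \<comment> \<open>(7)\<close>
    irreducible_graph V' E'"
proof -
  obtain R where R: "R \<subseteq> V \<times> V" "refl_on V R" "sym R" "locally_finite_on V R"
    "\<forall>x\<in>markov_regular V E. \<forall>y\<in>markov_regular V E. \<pi> x = \<pi> y \<longleftrightarrow> (\<forall>n. (x n, y n) \<in> R)"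
    using assms(3) unfolding excellent_semiconjugacy_def by (elim conjE exE) rule
  interpret ergodic_coding V E Y T \<pi> R \<mu>
    using assms R by unfold_locales (auto simp: excellent_semiconjugacy_def)
  obtain D G where D: "D \<in> Fpow V" "G \<in> sets Y" "emeasure \<mu> G \<noteq> 0"
    "\<And>y. y \<in> G \<Longrightarrow> fib y \<noteq> {} \<and> slice y 0 = D"
    by (rule exists_recurrent_slice) blast
  interpret typical_coding V E Y T \<pi> R \<mu> D G
    by unfold_locales (use D in auto)
  show ?thesis
  proof (intro exI[of _ V2] exI[of _ E2] exI[of _ sg.p'] exI[of _ sg.q] conjI impI allI ballI)
    show "countable_graph V2 E2" by (rule sg.graph')
    show "excellent_semiconjugacy V2 sg.Z' Y T sg.p'" by (rule sg.excellent_p')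
    show "\<exists>C'. multiplicity_bound V2 sg.Z' sg.p' C'" if "\<exists>C. multiplicity_bound V Z \<pi> C"
      using that sg.multiplicity_bound_p' by blast
    show "sg.q ` markov_shift E2 \<subseteq> markov_shift E" using sg.q_markov by blast
    show "one_lipschitz_on (markov_shift E2) sg.q" by (rule sg.q_lipschitz)
    show "sg.q ` sg.Z' \<subseteq> Z" "sg.p' ` sg.Z' \<subseteq> \<pi> ` Z" using sg.q_regular by (auto simp: sg.p'_def)
    show "sg.p' x = \<pi> (sg.q x)" for x by (rule sg.p'_def)
    show "AE y in \<mu>. card {x \<in> sg.Z'. sg.p' x = y} = 1" by (rule unique_preimage)
  qed (fact sg.locally_compact_lift sg.q_proper lifted_measure irreducible)+
qed

end
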